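(* Let $\mathbf m=\{\hat0=\pi_0\prec\pi_1\prec\cdots\prec\pi_k=\hat1\}$ be a maximal chain in $\mathrm{NC}^d_{dk+1}$ and let $T$ be the $d$-parking tree with $\lambda(\mathbf m)=\vec a(T)$. Identify each vertex $v$ of $T$ with the element $\omega(v)\in[dk+1]$, where $\omega$ is the depth-first search ordering of $T$. Then for each $0\le i\le k$, $\pi_i$ is the partition of $[dk+1]$ whose blocks are the vertex sets of the connected components of the graph on the vertices of $T$ containing exactly those edges of $T$ that connect a vertex $j_s$ to its parent, for $1\le j\le i$ and $1\le s\le d$. In particular, $\pi_i$ is obtained from $\pi_{i-1}$ by merging the blocks containing the $d+1$ elements $\omega(p_i),\omega(i_1),\dots,\omega(i_d)$, where $p_i$ is the common parent of $i_1,\dots,i_d$.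
   Context: A partition of $[n]$ is noncrossing if there are no $i<j<k<\ell$ with $i,k$ in one block and $j,\ell$ in a different block. The Kreweras dual $\pi'$ of a noncrossing partition $\pi$ of $[n]$: place $1,1',\dots,n,n'$ on a circle in this cyclic order; $\pi'$ is the coarsest partition of $\{1',\dots,n'\}$ such that the blocks of $\pi$ and of $\pi'$ together form a noncrossing partition of these $2n$ points. $\mathrm{NC}^d_n$ is the poset, ordered by refinement, of noncrossing partitions $\pi$ of $[n]$ such that every block of $\pi$ and of $\pi'$ has cardinality $\equiv1\bmod d$. Every cover $\pi\prec\sigma$ merges $d+1$ blocks $B_1,\dots,B_{d+1}$ of $\pi$ with $\min B_1<\cdots<\min B_{d+1}$, and $\lambda(\pi,\sigma)=\max\{i\in B_1:i<\min B_2\}$; $\lambda(\mathbf m)$ is the list of labels along $\mathbf m$. A $d$-parking tree is a rooted plane tree on $dk+1$ vertices in which each vertex has a multiple of $d$ children, with labels: root $\infty$; other vertices labeled $i_j$ ($1\le i\le k$, $1\le j\le d$), each label used once; $i_1,\dots,i_d$ are consecutive siblings in this left-to-right order; if $i_j,i'_{j'}$ are siblings with $i<i'$ then $i_j$ is to the right of $i'_{j'}$. The depth-first search ordering $\omega$ is the preorder numbering by $1,\dots,dk+1$ (root first, then the subtrees of the children from left to right recursively). $\vec a(T)=(a_1,\dots,a_k)$ where $a_i=\omega(\text{common parent of }i_1,\dots,i_d)$; the map $T\mapsto\vec a(T)$ is a bijection onto $d$-parking functions, and $\lambda(\mathbf m)$ is a $d$-parking function, so $T$ is well defined. *)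

theory Defs
  imports
    "HOL-Library.Disjoint_Sets"
    "HOL-Library.Sublist"
    "HOL-Number_Theory.Cong"
begin

definition noncrossing :: "nat set set \<Rightarrow> bool" where
  "noncrossing P \<longleftrightarrow>
     \<not> (\<exists>B\<in>P. \<exists>C\<in>P. B \<noteq> C \<and>
          (\<exists>i j k l. i < j \<and> j < k \<and> k < l \<and> i \<in> B \<and> k \<in> B \<and> j \<in> C \<and> l \<in> C))"

text \<open>The circular arrangement \<open>1, 1', \<dots>, n, n'\<close> is cut open before \<open>1\<close>: the point \<open>i\<close> is
  encoded as \<open>2 * i\<close> and the point \<open>i'\<close> as \<open>2 * i + 1\<close>.  Being noncrossing does not depend
  on where the circle is cut.  Partitions of \<open>{1', \<dots>, n'}\<close> are written as partitions
  of \<open>{1..n}\<close>, dropping the primes.\<close>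

definition interleave :: "nat set set \<Rightarrow> nat set set \<Rightarrow> nat set set" where
  "interleave P Q = (\<lambda>B. (\<lambda>i. 2 * i) ` B) ` P \<union> (\<lambda>C. (\<lambda>i. 2 * i + 1) ` C) ` Q"

definition kreweras :: "nat \<Rightarrow> nat set set \<Rightarrow> nat set set" where
  "kreweras n P =
     (THE Q. partition_on {1..n} Q \<and> noncrossing (interleave P Q) \<and>
        (\<forall>R. partition_on {1..n} R \<and> noncrossing (interleave P R) \<longrightarrow> refines {1..n} R Q))"

definition NCd :: "nat \<Rightarrow> nat \<Rightarrow> nat set set set" where
  "NCd d n = {P. partition_on {1..n} P \<and> noncrossing P \<and>
                 (\<forall>B\<in>P. [card B = 1] (mod d)) \<and>
                 (\<forall>B\<in>kreweras n P. [card B = 1] (mod d))}"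

definition NCd_less :: "nat \<Rightarrow> nat set set \<Rightarrow> nat set set \<Rightarrow> bool" where
  "NCd_less n P Q \<longleftrightarrow> refines {1..n} P Q \<and> P \<noteq> Q"

definition NCd_covers :: "nat \<Rightarrow> nat \<Rightarrow> nat set set \<Rightarrow> nat set set \<Rightarrow> bool" where
  "NCd_covers d n P Q \<longleftrightarrow>
     P \<in> NCd d n \<and> Q \<in> NCd d n \<and> NCd_less n P Q \<and>
     \<not> (\<exists>R\<in>NCd d n. NCd_less n P R \<and> NCd_less n R Q)"

text \<open>\<open>{{i} | i. i \<in> {1..n}}\<close> and \<open>{{1..n}}\<close> are the least and the greatest partition, so a
  sequence of covers between them is a maximal chain (\<open>NCd_maximal_chain_maxchain\<close> below).\<close>

definition NCd_maximal_chain :: "nat \<Rightarrow> nat \<Rightarrow> (nat \<Rightarrow> nat set set) \<Rightarrow> bool" where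
  "NCd_maximal_chain d k \<pi> \<longleftrightarrow>
     \<pi> 0 = {{i} | i. i \<in> {1..d * k + 1}} \<and> \<pi> k = {{1..d * k + 1}} \<and>
     \<pi> ` {..k} \<subseteq> NCd d (d * k + 1) \<and>
     (\<forall>i<k. NCd_covers d (d * k + 1) (\<pi> i) (\<pi> (Suc i)))"

lemma NCd_less_trans: "NCd_less n P Q \<Longrightarrow> NCd_less n Q R \<Longrightarrow> NCd_less n P R"
  unfolding NCd_less_def by (blast intro: refines_trans dest: refines_asym)

lemma NCd_maximal_chain_maxchain:
  assumes "NCd_maximal_chain d k \<pi>"
  shows "pred_on.maxchain (NCd d (d * k + 1)) (NCd_less (d * k + 1)) (\<pi> ` {..k})"
proof -
  define n where "n = d * k + 1"
  interpret pred_on "NCd d n" "NCd_less n" .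
  have bot: "\<pi> 0 = {{i} | i. i \<in> {1..n}}" and top: "\<pi> k = {{1..n}}"
    and sub: "\<pi> ` {..k} \<subseteq> NCd d n" and cov: "\<And>i. i < k \<Longrightarrow> NCd_covers d n (\<pi> i) (\<pi> (Suc i))"
    using assms unfolding NCd_maximal_chain_def n_def by auto
  have mono: "NCd_less n (\<pi> i) (\<pi> j)" if "i < j" "j \<le> k" for i j
    using that
  proof (induction j)
    case (Suc j)
    have s: "NCd_less n (\<pi> j) (\<pi> (Suc j))"
      using cov[of j] Suc.prems unfolding NCd_covers_def by simp
    then show ?case
      using Suc NCd_less_trans by (cases "i = j") auto
  qed simp
  have ch: "chain (\<pi> ` {..k})"
    unfolding chain_def
  proof (intro conjI sub ballI)
    fix x y assume "x \<in> \<pi> ` {..k}" "y \<in> \<pi> ` {..k}"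
    then obtain i j where "x = \<pi> i" "y = \<pi> j" "i \<le> k" "j \<le> k" by auto
    then show "(NCd_less n)\<^sup>=\<^sup>= x y \<or> (NCd_less n)\<^sup>=\<^sup>= y x"
      using mono[of i j] mono[of j i] by (cases i j rule: linorder_cases) auto
  qed
  have "S \<subseteq> \<pi> ` {..k}" if S: "chain S" "\<pi> ` {..k} \<subseteq> S" for S
  proof
    fix z assume z: "z \<in> S"
    then have zN: "z \<in> NCd d n"
      using S unfolding chain_def by blast
    then have pz: "partition_on {1..n} z"
      unfolding NCd_def by blast
    have cmp: "NCd_less n z (\<pi> i) \<or> z = \<pi> i \<or> NCd_less n (\<pi> i) z" if "i \<le> k" for i
      using S z that unfolding chain_def by blast
    show "z \<in> \<pi> ` {..k}"
    proof (rule ccontr)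
      assume nz: "z \<notin> \<pi> ` {..k}"
      have up: "NCd_less n (\<pi> i) z" if "i \<le> k" for i
        using that
      proof (induction i)
        case 0
        have "refines {1..n} (\<pi> 0) z"
          unfolding refines_def
        proof (intro conjI pz ballI)
          show "partition_on {1..n} (\<pi> 0)" using sub unfolding NCd_def by blast
          fix X assume "X \<in> \<pi> 0"
          then obtain i where "X = {i}" "i \<in> {1..n}" unfolding bot by auto
          then show "\<exists>Y\<in>z. X \<subseteq> Y" using pz unfolding partition_on_def by blast
        qed
        moreover have "\<pi> 0 \<noteq> z"
          using nz by blast
        ultimately show ?case unfolding NCd_less_def by blast
      next
        case (Suc i)
        have "\<not> NCd_less n z (\<pi> (Suc i))"
          using cov[of i] Suc.IH Suc.prems zN unfolding NCd_covers_def by fastforce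
        moreover have "z \<noteq> \<pi> (Suc i)"
          using nz Suc.prems by blast
        ultimately show ?case using cmp[OF Suc.prems] by blast
      qed
      have "refines {1..n} z (\<pi> k)"
        unfolding refines_def
      proof (intro conjI pz ballI)
        show "partition_on {1..n} (\<pi> k)" using sub unfolding NCd_def by blast
        fix X assume "X \<in> z"
        then show "\<exists>Y\<in>\<pi> k. X \<subseteq> Y" using pz unfolding partition_on_def top by blast
      qed
      then show False
        using up[of k] refines_asym[of "{1..n}" z "\<pi> k"] unfolding NCd_less_def by simp
    qed
  qed
  then have "maxchain (\<pi> ` {..k})"
    using ch unfolding maxchain_def by (meson psubset_imp_subset leD)
  then show ?thesis
    unfolding n_def .
qed

text \<open>The blocks \<open>B\<^sub>1, \<dots>, B\<^sub>d\<^sub>+\<^sub>1\<close> that are merged in passing from \<open>P\<close> to \<open>Q\<close> are the elements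
  of \<open>P - Q\<close>; the list is 0-indexed.\<close>

definition merged_blocks :: "nat set set \<Rightarrow> nat set set \<Rightarrow> nat set list" where
  "merged_blocks P Q = sorted_key_list_of_set Min (P - Q)"

definition cover_label :: "nat set set \<Rightarrow> nat set set \<Rightarrow> nat" where
  "cover_label P Q =
     Max {i \<in> merged_blocks P Q ! 0. i < Min (merged_blocks P Q ! 1)}"

definition chain_labels :: "nat \<Rightarrow> (nat \<Rightarrow> nat set set) \<Rightarrow> nat list" where
  "chain_labels k \<pi> = map (\<lambda>i. cover_label (\<pi> (i - 1)) (\<pi> i)) [1..<k + 1]"

datatype 'a ptree = Node (rlabel: 'a) (subtrees: "'a ptree list")

fun preorder :: "'a ptree \<Rightarrow> 'a list" where
  "preorder (Node a ts) = a # concat (map preorder ts)"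

fun nodes :: "'a ptree \<Rightarrow> 'a ptree set" where
  "nodes (Node a ts) = insert (Node a ts) (\<Union>t\<in>set ts. nodes t)"

definition child_labels :: "'a ptree \<Rightarrow> 'a list" where
  "child_labels S = map rlabel (subtrees S)"

text \<open>\<open>Lab i j\<close> is the label \<open>i\<^sub>j\<close>.\<close>

datatype vlabel = Infty | Lab nat nat

definition d_parking_tree :: "nat \<Rightarrow> nat \<Rightarrow> vlabel ptree \<Rightarrow> bool" where
  "d_parking_tree d k T \<longleftrightarrow>
     length (preorder T) = d * k + 1 \<and>
     (\<forall>S\<in>nodes T. d dvd length (child_labels S)) \<and>
     rlabel T = Infty \<and>
     distinct (preorder T) \<and>
     set (preorder T) = insert Infty {Lab i j | i j. i \<in> {1..k} \<and> j \<in> {1..d}} \<and>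
     (\<forall>i\<in>{1..k}. \<exists>S\<in>nodes T. sublist (map (Lab i) [1..<d + 1]) (child_labels S)) \<and>
     (\<forall>S\<in>nodes T. \<forall>p<length (child_labels S). \<forall>q<length (child_labels S). \<forall>i j i' j'.
        child_labels S ! p = Lab i j \<and> child_labels S ! q = Lab i' j' \<and> i < i' \<longrightarrow> q < p)"

text \<open>The labels of a parking tree are distinct, so vertices are represented by their labels.\<close>

definition parent_edges :: "'a ptree \<Rightarrow> ('a \<times> 'a) set" where
  "parent_edges T = {(rlabel S, c) | S c. S \<in> nodes T \<and> c \<in> set (child_labels S)}"

definition parent :: "'a ptree \<Rightarrow> 'a \<Rightarrow> 'a" where
  "parent T v = (THE p. (p, v) \<in> parent_edges T)"

definition common_parent :: "nat \<Rightarrow> vlabel ptree \<Rightarrow> nat \<Rightarrow> vlabel" where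
  "common_parent d T i = (THE p. \<forall>j\<in>{1..d}. (p, Lab i j) \<in> parent_edges T)"

text \<open>The 1-based position of \<open>v\<close> in the preorder listing.\<close>

definition dfs :: "'a ptree \<Rightarrow> 'a \<Rightarrow> nat" where
  "dfs T v = length (takeWhile (\<lambda>u. u \<noteq> v) (preorder T)) + 1"

definition parking_vector :: "nat \<Rightarrow> nat \<Rightarrow> vlabel ptree \<Rightarrow> nat list" where
  "parking_vector d k T = map (\<lambda>i. dfs T (common_parent d T i)) [1..<k + 1]"

definition components :: "'a set \<Rightarrow> ('a \<times> 'a) set \<Rightarrow> 'a set set" where
  "components V E = V // {(u, v). u \<in> V \<and> v \<in> V \<and> (u, v) \<in> (E \<union> E\<inverse>)\<^sup>*}"

definition initial_edges :: "nat \<Rightarrow> vlabel ptree \<Rightarrow> nat \<Rightarrow> (vlabel \<times> vlabel) set" where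
  "initial_edges d T i = {(parent T (Lab j s), Lab j s) | j s. j \<in> {1..i} \<and> s \<in> {1..d}}"

definition merge_blocks :: "'a set set \<Rightarrow> 'a set \<Rightarrow> 'a set set" where
  "merge_blocks P X = insert (\<Union>{B \<in> P. B \<inter> X \<noteq> {}}) {B \<in> P. B \<inter> X = {}}"

end

theory Submission
  imports Defs
begin

text \<open>In a member of \<open>NC\<^sup>d\<^sub>n\<close> the gap between two consecutive elements of a block has size divisible
  by \<open>d\<close>.  Counting blocks shows that every step of a maximal chain merges exactly \<open>d + 1\<close> blocks;
  since a gap of one of them contains a multiple of \<open>d\<close> of the others, \<open>B\<^sub>2, \<dots>, B\<^sub>d\<^sub>+\<^sub>1\<close> are consecutive
  intervals of the merged block \<open>C\<close>, the first one beginning right after the label.  Within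
  each block the labels used so far form a \<open>d\<close>-parking function, which determines where these
  intervals end.  So the labels determine the chain, from the top down.  The partitions
  read off from the tree split in the same way with the same labels: \<open>B\<^sub>s\<^sub>+\<^sub>1\<close> is the part of \<open>C\<close> in
  the subtree of \<open>i\<^sub>s\<close>, a preorder interval, and the subtrees of the siblings to the left of
  \<open>i\<^sub>1\<close> do not meet \<open>C\<close>.\<close>

subsection \<open>Consecutive elements of blocks\<close>

text \<open>The comparison runs from the top because a label names an element, not the blocks to be
  merged: the block \<open>C\<close> to be split is known only once the coarser partition is, as the
  block containing the label. Two cuts of \<open>C\<close> that start at the same place but end at
  different ones would make one piece a proper initial part of the other. A piece has
  \<open>d * c + 1\<close> elements, where \<open>c\<close> counts the labels used so far that lie
  in it, whereas a proper initial part of a piece has at most \<open>d\<close> times its own label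
  count. Since the comparison uses only \<open>interval_split\<close>, the partitions of the tree
  need not be shown to be noncrossing or to have a dual with the right block sizes. That exactly
  \<open>d + 1\<close> blocks merge is a matter of total length: a strict refinement in
  \<open>NCd\<close> has at least \<open>d\<close> more blocks, and \<open>k\<close> steps lead from
  \<open>d * k + 1\<close> blocks to one.\<close>

definition unit_gaps :: "nat \<Rightarrow> nat set \<Rightarrow> bool" where
  "unit_gaps d S \<longleftrightarrow> (\<forall>x\<in>S. \<forall>y\<in>S. x < y \<and> S \<inter> {x<..<y} = {} \<longrightarrow> [y = x + 1] (mod d))"

lemma unit_gaps_cong_card:
  assumes "unit_gaps d S" "x \<in> S" "y \<in> S" "x \<le> y"
  shows "[y = x + card (S \<inter> {x<..y})] (mod d)"
  using assms(3,4)
proof (induction y rule: less_induct)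
  case (less y)
  show ?case
  proof (cases "x = y")
    case False
    define z where "z = Max (S \<inter> {x..<y})"
    have fin: "finite (S \<inter> {x..<y})" by simp
    have "S \<inter> {x..<y} \<noteq> {}" using assms(2) less.prems False by auto
    then have z: "z \<in> S" "x \<le> z" "z < y"
      using Max_in[OF fin] unfolding z_def by auto
    have above: "w \<le> z" if "w \<in> S" "x \<le> w" "w < y" for w
      unfolding z_def by (rule Max_ge[OF fin]) (use that in auto)
    have empty: "S \<inter> {z<..<y} = {}"
      using above z(2) by fastforce
    then have "[y = z + 1] (mod d)"
      using assms(1) z(1,3) less.prems(1) unfolding unit_gaps_def by blast
    moreover have "[z = x + card (S \<inter> {x<..z})] (mod d)"
      using less.IH z by blast
    moreover have "S \<inter> {x<..y} = insert y (S \<inter> {x<..z})"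
      using above z less.prems by fastforce
    then have "card (S \<inter> {x<..y}) = Suc (card (S \<inter> {x<..z}))"
      using z by simp
    ultimately show ?thesis
      using cong_add_rcancel_nat[of z 1 "x + card (S \<inter> {x<..z})" d] by (auto intro: cong_trans)
  qed simp
qed

text \<open>There are \<open>card S - 1\<close> steps from the least to the greatest element, a
  multiple of \<open>d\<close>, and each step counts as 1 modulo \<open>d\<close>. The lemma serves
  blocks of a partition and blocks of its dual alike.\<close>

lemma unit_gaps_Max:
  assumes "unit_gaps d S" "finite S" "S \<noteq> {}" "[card S = 1] (mod d)"
  shows "[Max S = Min S] (mod d)"
proof -
  have "S = insert (Min S) (S \<inter> {Min S<..Max S})"
    using Min_in[OF assms(2,3)] Min_le[OF assms(2)] Max_ge[OF assms(2)]
    by (auto simp del: Min_le Max_ge) (metis le_neq_implies_less)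
  then have "card S = Suc (card (S \<inter> {Min S<..Max S}))"
    by (metis card_insert_disjoint finite_Int finite_greaterThanAtMost IntD2 greaterThanAtMost_iff less_irrefl)
  then have "[card (S \<inter> {Min S<..Max S}) = 0] (mod d)"
    using assms(4) by (metis One_nat_def Suc_eq_plus1 add_0 cong_add_rcancel_nat)
  moreover have "[Max S = Min S + card (S \<inter> {Min S<..Max S})] (mod d)"
    using unit_gaps_cong_card[OF assms(1)] assms(2,3) by simp
  ultimately show ?thesis
    by (metis add.right_neutral cong_add_lcancel_nat cong_trans)
qed

subsection \<open>The Kreweras dual\<close>

text \<open>The pairs in a common block that are separated by the point \<open>i'\<close>.\<close>

definition arcs :: "nat set set \<Rightarrow> nat \<Rightarrow> (nat \<times> nat) set" where
  "arcs P i = {(x, y). \<exists>B\<in>P. x \<in> B \<and> y \<in> B \<and> x \<le> i \<and> i < y}"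

lemma arcs_bounds: "(x, y) \<in> arcs P i \<Longrightarrow> x \<le> i \<and> i < y"
  unfolding arcs_def by blast

text \<open>An arc over both \<open>i'\<close> and \<open>k'\<close> starts at or before
  \<open>i\<close> and ends after \<open>k\<close>, so it passes over everything between.\<close>

lemma arcs_between:
  assumes "i \<le> j" "j \<le> k"
  shows "arcs P i \<inter> arcs P k \<subseteq> arcs P j"
proof (rule subrelI)
  fix x y assume "(x, y) \<in> arcs P i \<inter> arcs P k"
  then obtain B where "B \<in> P" "x \<in> B" "y \<in> B" "x \<le> i" "k < y"
    unfolding arcs_def by blast
  then show "(x, y) \<in> arcs P j" using assms unfolding arcs_def by auto
qed

lemma noncrossingD:
  assumes "noncrossing P" "B \<in> P" "C \<in> P" "i \<in> B" "k \<in> B" "j \<in> C" "l \<in> C"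
    "i < j" "j < k" "k < l"
  shows "B = C"
  using assms unfolding noncrossing_def by blast

lemma partition_on_same_block:
  assumes "partition_on A P" "B \<in> P" "C \<in> P" "x \<in> B" "x \<in> C"
  shows "B = C"
  using assms unfolding partition_on_def disjoint_def by blast

lemma partition_on_kernel: "partition_on A ((\<lambda>i. {j \<in> A. f j = f i}) ` A)"
  unfolding partition_on_def disjoint_def by auto

text \<open>The candidate for the dual puts \<open>i'\<close> and \<open>j'\<close> together when no
  arc of \<open>P\<close> separates them, that is, when they lie under the same arcs. There are four
  kinds of possible crossings, according to the parities of the two sets.\<close>

lemma interleave_noncrossing_arcs:
  assumes "noncrossing P"
  shows "noncrossing (interleave P ((\<lambda>i. {j \<in> {1..n}. arcs P j = arcs P i}) ` {1..n}))"
    (is "noncrossing (interleave P ?Q)")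
  unfolding noncrossing_def
proof clarify
  fix B C i j k l
  assume B: "B \<in> interleave P ?Q" and C: "C \<in> interleave P ?Q" and "B \<noteq> C"
    and lt: "i < j" "j < k" "k < l" and mem: "i \<in> B" "k \<in> B" "j \<in> C" "l \<in> C"
  have cases: "(\<exists>X\<in>P. D = (\<lambda>i. 2 * i) ` X) \<or>
      (\<exists>m\<in>{1..n}. D = (\<lambda>i. 2 * i + 1) ` {j \<in> {1..n}. arcs P j = arcs P m})"
    if "D \<in> interleave P ?Q" for D
    using that unfolding interleave_def by blast
  have even: thesis
    if "D = (\<lambda>i. 2 * i) ` X" "u \<in> D" "v \<in> D"
      "\<And>u' v'. u' \<in> X \<Longrightarrow> v' \<in> X \<Longrightarrow> u = 2 * u' \<Longrightarrow> v = 2 * v' \<Longrightarrow> thesis"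
    for D X u v and thesis
    using that by blast
  have odd: thesis
    if "D = (\<lambda>i. 2 * i + 1) ` {j \<in> {1..n}. arcs P j = arcs P m}" "u \<in> D" "v \<in> D"
      "\<And>u' v'. arcs P u' = arcs P m \<Longrightarrow> arcs P v' = arcs P m \<Longrightarrow>
        u = 2 * u' + 1 \<Longrightarrow> v = 2 * v' + 1 \<Longrightarrow> thesis"
    for D m u v and thesis
    using that by blast
  from cases[OF B] show False
  proof (elim disjE bexE)
    fix X assume X: "X \<in> P" "B = (\<lambda>i. 2 * i) ` X"
    obtain i' k' where ik: "i' \<in> X" "k' \<in> X" "i = 2 * i'" "k = 2 * k'"
      using even[OF X(2) mem(1,2)] .
    from cases[OF C] show False
    proof (elim disjE bexE)
      fix Y assume Y: "Y \<in> P" "C = (\<lambda>i. 2 * i) ` Y"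
      obtain j' l' where "j' \<in> Y" "l' \<in> Y" "j = 2 * j'" "l = 2 * l'"
        using even[OF Y(2) mem(3,4)] .
      then have "X = Y" using noncrossingD[OF assms X(1) Y(1), of i' k' j' l'] ik lt by simp
      then show False using X(2) Y(2) \<open>B \<noteq> C\<close> by simp
    next
      fix m assume m: "C = (\<lambda>i. 2 * i + 1) ` {j \<in> {1..n}. arcs P j = arcs P m}"
      obtain j' l' where jl: "arcs P j' = arcs P m" "arcs P l' = arcs P m"
        "j = 2 * j' + 1" "l = 2 * l' + 1"
        using odd[OF m mem(3,4)] .
      \<comment> \<open>A block of \<open>P\<close> that crosses a dual class contains an arc over
        one member of the class but not over the other.\<close>
      have "(i', k') \<in> arcs P j'" "(i', k') \<notin> arcs P l'"
        using X(1) ik jl(3,4) lt unfolding arcs_def by auto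
      then show False using jl by simp
    qed
  next
    fix m assume m: "B = (\<lambda>i. 2 * i + 1) ` {j \<in> {1..n}. arcs P j = arcs P m}"
    obtain i' k' where ik: "arcs P i' = arcs P m" "arcs P k' = arcs P m"
      "i = 2 * i' + 1" "k = 2 * k' + 1"
      using odd[OF m mem(1,2)] .
    from cases[OF C] show False
    proof (elim disjE bexE)
      fix Y assume Y: "Y \<in> P" "C = (\<lambda>i. 2 * i) ` Y"
      obtain j' l' where jl: "j' \<in> Y" "l' \<in> Y" "j = 2 * j'" "l = 2 * l'"
        using even[OF Y(2) mem(3,4)] .
      have "(j', l') \<in> arcs P k'" "(j', l') \<notin> arcs P i'"
        using Y(1) jl ik(3,4) lt unfolding arcs_def by auto
      then show False using ik by simp
    next
      fix m' assume m': "C = (\<lambda>i. 2 * i + 1) ` {j \<in> {1..n}. arcs P j = arcs P m'}"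
      obtain j' l' where jl: "arcs P j' = arcs P m'" "arcs P l' = arcs P m'"
        "j = 2 * j' + 1" "l = 2 * l' + 1"
        using odd[OF m' mem(3,4)] .
      \<comment> \<open>For two crossing dual classes, the arcs common to \<open>i'\<close> and
        \<open>k'\<close> lie over \<open>j'\<close>, and those common to \<open>j'\<close> and
        \<open>l'\<close> lie over \<open>k'\<close>. The two inclusions make the arc sets of the
        classes equal.\<close>
      have "i' < j'" "j' < k'" "k' < l'" using lt ik(3,4) jl(3,4) by linarith+
      then have "arcs P i' \<inter> arcs P k' \<subseteq> arcs P j'" "arcs P j' \<inter> arcs P l' \<subseteq> arcs P k'"
        using arcs_between by simp_all
      then have "arcs P m = arcs P m'" using ik jl by simp
      then show False using m m' \<open>B \<noteq> C\<close> by simp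
    qed
  qed
qed

text \<open>An arc over just one of the two primed points has exactly one end between them and so
  crosses their block. Noncrossing would then identify a set of even numbers with a set of odd ones,
  which \<open>ne\<close> excludes.\<close>

lemma arcs_eq_if_interleave_noncrossing:
  assumes nc: "noncrossing (interleave P R)" and Y: "Y \<in> R" "j \<in> Y" "l \<in> Y" and "j < l"
  shows "arcs P j = arcs P l"
proof -
  have ne: "(\<lambda>i. 2 * i) ` X \<noteq> (\<lambda>i. 2 * i + 1) ` Y" if "x \<in> X" for X :: "nat set" and x
  proof
    assume "(\<lambda>i. 2 * i) ` X = (\<lambda>i. 2 * i + 1) ` Y"
    then have "2 * x \<in> (\<lambda>i. 2 * i + 1) ` Y" using that by blast
    then show False by auto presburger
  qed
  have B: "(\<lambda>i. 2 * i) ` X \<in> interleave P R" if "X \<in> P" for X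
    using that unfolding interleave_def by blast
  have C: "(\<lambda>i. 2 * i + 1) ` Y \<in> interleave P R"
    using Y(1) unfolding interleave_def by blast
  have 1: "\<not> l < y" if "X \<in> P" "x \<in> X" "y \<in> X" "j < x" "x \<le> l" for X x y
  proof
    assume "l < y"
    then have "(\<lambda>i. 2 * i + 1) ` Y = (\<lambda>i. 2 * i) ` X"
      using noncrossingD[OF nc C B[OF that(1)], of "2 * j + 1" "2 * l + 1" "2 * x" "2 * y"]
        Y(2,3) that(2-5) by simp
    then show False using ne[OF that(2)] by simp
  qed
  have 2: "\<not> (j < y \<and> y \<le> l)" if "X \<in> P" "x \<in> X" "y \<in> X" "x \<le> j" for X x y
  proof
    assume "j < y \<and> y \<le> l"
    then have "(\<lambda>i. 2 * i) ` X = (\<lambda>i. 2 * i + 1) ` Y"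
      using noncrossingD[OF nc B[OF that(1)] C, of "2 * x" "2 * y" "2 * j + 1" "2 * l + 1"]
        Y(2,3) that(2-4) by simp
    then show False using ne[OF that(2)] by simp
  qed
  have "x \<le> j \<and> j < y \<longleftrightarrow> x \<le> l \<and> l < y" if "X \<in> P" "x \<in> X" "y \<in> X" for X x y
    using 1[OF that] 2[OF that] \<open>j < l\<close> by linarith
  then show ?thesis
    unfolding arcs_def by blast
qed

text \<open>This replaces the definite description by a kernel: by the two preceding lemmas the
  kernel is admissible and coarser than every admissible partition, and antisymmetry of refinement
  makes it the only such partition.\<close>

lemma kreweras_eq:
  assumes "noncrossing P"
  shows "kreweras n P = (\<lambda>i. {j \<in> {1..n}. arcs P j = arcs P i}) ` {1..n}" (is "_ = ?Q")
  unfolding kreweras_def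
proof (rule the_equality)
  have coarsest: "refines {1..n} R ?Q" if R: "partition_on {1..n} R" "noncrossing (interleave P R)" for R
    unfolding refines_def
  proof (intro conjI partition_on_kernel R ballI)
    fix Y assume Y: "Y \<in> R"
    then obtain i where i: "i \<in> Y" using R(1) unfolding partition_on_def by fastforce
    have sub: "Y \<subseteq> {1..n}" using R(1) Y unfolding partition_on_def by blast
    have "arcs P j = arcs P i" if "j \<in> Y" for j
      using arcs_eq_if_interleave_noncrossing[OF R(2) Y] that i by (metis linorder_neqE_nat)
    then have "Y \<subseteq> {j \<in> {1..n}. arcs P j = arcs P i}" using sub by blast
    moreover have "i \<in> {1..n}" using i sub by blast
    ultimately show "\<exists>Z\<in>?Q. Y \<subseteq> Z" by blast
  qed
  show Q: "partition_on {1..n} ?Q \<and> noncrossing (interleave P ?Q) \<and>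
      (\<forall>R. partition_on {1..n} R \<and> noncrossing (interleave P R) \<longrightarrow> refines {1..n} R ?Q)"
    using partition_on_kernel[of "{1..n}" "arcs P"] interleave_noncrossing_arcs[OF assms] coarsest by blast
  show "Q' = ?Q" if "partition_on {1..n} Q' \<and> noncrossing (interleave P Q') \<and>
      (\<forall>R. partition_on {1..n} R \<and> noncrossing (interleave P R) \<longrightarrow> refines {1..n} R Q')" for Q'
    using that Q refines_asym by blast
qed

text \<open>The dual class of \<open>x\<close> cuts the gap between \<open>x\<close> and \<open>y\<close> into pieces, each of which is
  spanned by a single block whose own gaps are shorter.\<close>

lemma NCd_unit_gaps:
  assumes P: "P \<in> NCd d n" and "B \<in> P"
  shows "unit_gaps d B"
proof -
  have part: "partition_on {1..n} P" and nc: "noncrossing P"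
    and cardP: "\<And>B. B \<in> P \<Longrightarrow> [card B = 1] (mod d)"
    using P unfolding NCd_def by auto
  have cardK: "[card {j \<in> {1..n}. arcs P j = arcs P i} = 1] (mod d)" if "i \<in> {1..n}" for i
    using P that kreweras_eq[OF nc, of n] unfolding NCd_def by auto
  have sub: "B \<subseteq> {1..n}" if "B \<in> P" for B
    using part that unfolding partition_on_def by blast
  note same = partition_on_same_block[OF part]
  have "[y = x + 1] (mod d)"
    if "B \<in> P" "x \<in> B" "y \<in> B" "x < y" "B \<inter> {x<..<y} = {}" for B x y
    using that
  proof (induction "y - x" arbitrary: B x y rule: less_induct)
    case less
    note B = less.prems
    \<comment> \<open>\<open>K\<close> is the dual block of \<open>x'\<close>. It turns out to run
      from \<open>x\<close> to \<open>y - 1\<close>, so unit gaps and cardinality 1 modulo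
      \<open>d\<close> give \<open>y - 1\<close> congruent to \<open>x\<close>.\<close>
    define K where "K = {j \<in> {1..n}. arcs P j = arcs P x}"
    have n: "x \<in> {1..n}" "y \<in> {1..n}" using sub[OF B(1)] B(2,3) by blast+
    have inside: "w \<le> x \<or> y \<le> w" if "w \<in> B" for w
    proof (rule ccontr)
      assume "\<not> (w \<le> x \<or> y \<le> w)"
      then have "w \<in> B \<inter> {x<..<y}" using that by simp
      then show False using B(5) by simp
    qed
    have xy: "(x, y) \<in> arcs P x" using B(1-4) unfolding arcs_def by blast
    have K_range: "x \<le> j \<and> j < y" if "j \<in> K" for j
    proof -
      have "(x, y) \<in> arcs P j" using xy that unfolding K_def by simp
      then show ?thesis by (blast dest: arcs_bounds)
    qed
    have xK: "x \<in> K" using n unfolding K_def by simp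
    \<comment> \<open>An arc over only one of \<open>x'\<close> and \<open>(y - 1)'\<close> would
      have exactly one end strictly inside the gap, hence cross \<open>B\<close>; arcs of
      \<open>B\<close> itself have no end there.\<close>
    have "arcs P (y - 1) = arcs P x"
    proof -
      have "(u, v) \<in> arcs P (y - 1) \<longleftrightarrow> (u, v) \<in> arcs P x" for u v
      proof -
        have "u \<le> y - 1 \<and> y - 1 < v \<longleftrightarrow> u \<le> x \<and> x < v" if D: "D \<in> P" "u \<in> D" "v \<in> D" for D
        proof (cases "D = B")
          case True
          then show ?thesis using inside D B(4) by fastforce
        next
          case False
          then have ne: "u \<noteq> x" "u \<noteq> y" "v \<noteq> x" "v \<noteq> y" using same[of D B] D B by auto
          have "\<not> (x < v \<and> v < y)" if "u < x"
            using noncrossingD[OF nc D(1) B(1), of u v x y] D B False that by auto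
          moreover have "\<not> y < v" if "x < u" "u < y"
            using noncrossingD[OF nc B(1) D(1), of x y u v] D B False that by auto
          ultimately show ?thesis using ne B(4) by linarith
        qed
        then show ?thesis unfolding arcs_def by blast
      qed
      then show ?thesis by auto
    qed
    then have yK: "y - 1 \<in> K" using n B(4) unfolding K_def by auto
    \<comment> \<open>Between consecutive members \<open>c < e\<close> of \<open>K\<close>, the
      block \<open>D\<close> of \<open>c + 1\<close> fills the space from end to end: it cannot
      leave it, as \<open>c'\<close> and \<open>e'\<close> lie under the same arcs, and its maximum
      belongs to \<open>K\<close> and hence is \<open>e\<close>.\<close>
    have "unit_gaps d K"
      unfolding unit_gaps_def
    proof (intro ballI impI, elim conjE)
      fix c e assume c: "c \<in> K" "e \<in> K" "c < e" "K \<inter> {c<..<e} = {}"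
      have ce: "arcs P c = arcs P e" "arcs P c = arcs P x" using c unfolding K_def by auto
      have "c + 1 \<in> {1..n}" using c(3) c(2) unfolding K_def by auto
      then obtain D where D: "D \<in> P" "c + 1 \<in> D" using part unfolding partition_on_def by blast
      have fin: "finite D" using sub[OF D(1)] finite_subset by blast
      have low: "c + 1 \<le> u" if "u \<in> D" for u
      proof (rule ccontr)
        assume "\<not> c + 1 \<le> u"
        then have "(u, c + 1) \<in> arcs P c" using D that unfolding arcs_def by auto
        then have "(u, c + 1) \<in> arcs P e" using ce by simp
        then show False using c(3) by (auto dest: arcs_bounds)
      qed
      have high: "u \<le> e" if "u \<in> D" for u
      proof (rule ccontr)
        assume "\<not> u \<le> e"
        then have "(c + 1, u) \<in> arcs P e" using D that c(3) unfolding arcs_def by auto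
        then have "(c + 1, u) \<in> arcs P c" using ce by simp
        then show False by (auto dest: arcs_bounds)
      qed
      define m where "m = Max D"
      have m: "m \<in> D" "\<And>u. u \<in> D \<Longrightarrow> u \<le> m"
        using fin D(2) unfolding m_def by (auto intro: Max_in)
      \<comment> \<open>An arc over \<open>m'\<close> but not over \<open>c'\<close> would start
        inside \<open>D\<close> and cross it; an arc over \<open>c'\<close> also lies over
        \<open>e'\<close> and therefore over \<open>m'\<close>.\<close>
      have "arcs P m = arcs P c"
      proof (rule equalityI; rule subrelI)
        fix u v assume "(u, v) \<in> arcs P m"
        then obtain X where X: "X \<in> P" "u \<in> X" "v \<in> X" "u \<le> m" "m < v" unfolding arcs_def by blast
        have "X \<noteq> D" using X m(2)[of v] by auto
        then have "u \<noteq> c + 1" "u \<noteq> m" using same[of X D] X D m by auto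
        moreover have "\<not> (c + 1 < u \<and> u < m)"
          using noncrossingD[OF nc D(1) X(1), of "c + 1" m u v] D m(1) X \<open>X \<noteq> D\<close> by auto
        ultimately have "u \<le> c" using X by linarith
        then show "(u, v) \<in> arcs P c" using X low[OF m(1)] unfolding arcs_def by auto
      next
        fix u v assume uv: "(u, v) \<in> arcs P c"
        then have "(u, v) \<in> arcs P e" using ce by simp
        then have "e < v" by (blast dest: arcs_bounds)
        moreover obtain X where "X \<in> P" "u \<in> X" "v \<in> X" "u \<le> c"
          using uv unfolding arcs_def by blast
        moreover have "u \<le> m" "m < v"
          using \<open>u \<le> c\<close> \<open>e < v\<close> high[OF m(1)] low[OF m(1)] by linarith+
        ultimately show "(u, v) \<in> arcs P m" unfolding arcs_def by blast
      qed
      then have "m \<in> K" using ce(2) subsetD[OF sub[OF D(1)] m(1)] unfolding K_def by simp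
      then have "\<not> (c < m \<and> m < e)" using c(4) by fastforce
      then have "m = e" using low[OF m(1)] high[OF m(1)] by linarith
      have "unit_gaps d D"
        unfolding unit_gaps_def
      proof (intro ballI impI, elim conjE)
        fix u v assume uv: "u \<in> D" "v \<in> D" "u < v" "D \<inter> {u<..<v} = {}"
        \<comment> \<open>\<open>D\<close> lies in \<open>{c + 1..e}\<close> with
          \<open>x \<le> c\<close> and \<open>e < y\<close>, so its gaps are shorter and the
          induction hypothesis applies.\<close>
        have "v - u < y - x"
          using low[OF uv(1)] high[OF uv(2)] K_range[OF c(1)] K_range[OF c(2)] uv(3) by linarith
        then show "[v = u + 1] (mod d)" using less.hyps D(1) uv by blast
      qed
      then have "[Max D = Min D] (mod d)"
        using unit_gaps_Max[of d D] fin D(2) cardP[OF D(1)] by blast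
      moreover have "Min D = c + 1" using D(2) low fin by (meson Min_eqI)
      ultimately show "[e = c + 1] (mod d)"
        using \<open>m = e\<close> unfolding m_def by simp
    qed
    moreover have "[card K = 1] (mod d)" using cardK[OF n(1)] unfolding K_def .
    moreover have "finite K" unfolding K_def by simp
    ultimately have "[Max K = Min K] (mod d)" using unit_gaps_Max[of d K] xK by blast
    moreover have "Min K = x" using xK K_range \<open>finite K\<close> by (meson Min_eqI)
    moreover have "Max K = y - 1" using yK K_range \<open>finite K\<close>
      by (intro Max_eqI) fastforce+
    ultimately have "[y - 1 + 1 = x + 1] (mod d)" by (simp only: cong_add_rcancel_nat)
    then show ?case using B(4) by simp
  qed
  then show ?thesis using assms(2) unfolding unit_gaps_def by blast
qed

subsection \<open>Covers split a block into intervals\<close>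

text \<open>Relative to \<open>C\<close>, the blocks \<open>B\<^sub>2, \<dots>, B\<^sub>d\<^sub>+\<^sub>1\<close> of \<open>P\<close> are the consecutive intervals that follow
  the label \<open>a\<close>, cut out by the thresholds \<open>t\<close>.\<close>

definition interval_split :: "nat \<Rightarrow> nat \<Rightarrow> nat set set \<Rightarrow> nat set set \<Rightarrow> bool" where
  "interval_split d a P Q \<longleftrightarrow>
     (\<exists>C\<in>Q. \<exists>t. a \<in> C \<and> t 0 = a \<and> (\<forall>s<d. t s \<le> t (Suc s)) \<and>
        P = (Q - {C}) \<union> insert (C - {t 0<..t d}) ((\<lambda>s. C \<inter> {t s<..t (Suc s)}) ` {..<d}))"

section \<open>Counting blocks in a strict refinement\<close>

lemma card_cong_card_partition:
  assumes "finite A" "partition_on A P" "\<And>B. B \<in> P \<Longrightarrow> [card B = 1] (mod d)"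
  shows "[card A = card P] (mod d)"
proof -
  have "card A = (\<Sum>B\<in>P. card B)"
    using product_partition[OF assms(2)] assms(1,2) unfolding partition_on_def
    by (metis Sup_upper finite_subset)
  moreover have "[(\<Sum>B\<in>P. card B) = (\<Sum>B\<in>P. 1)] (mod d)"
    using assms(3) by (rule cong_sum)
  ultimately show ?thesis by simp
qed

text \<open>Modulo \<open>d\<close>, the number of pieces of a block \<open>C\<close> of
  \<open>Q\<close> agrees with \<open>card C\<close>, hence with 1; so a block that is really split
  has at least \<open>d + 1\<close> pieces. If only \<open>d\<close> blocks are gained in total, a
  single block is split, into exactly \<open>d + 1\<close>. The first conclusion is summed along the
  chain, the second then describes each step.\<close>

lemma refines_card_ge:
  fixes d :: nat
  assumes "finite A" "d \<ge> 1" "refines A P Q" "P \<noteq> Q"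
    and cP: "\<And>B. B \<in> P \<Longrightarrow> [card B = 1] (mod d)" and cQ: "\<And>B. B \<in> Q \<Longrightarrow> [card B = 1] (mod d)"
  shows "card Q + d \<le> card P"
    and "card P = card Q + d \<Longrightarrow>
      \<exists>C\<in>Q. partition_on C (P - Q) \<and> card (P - Q) = d + 1 \<and> P = (Q - {C}) \<union> (P - Q)"
proof -
  define parts where "parts = (\<lambda>C. {B \<in> P. B \<subseteq> C})"
  have P: "partition_on A P" and Q: "partition_on A Q" and sub: "\<And>B. B \<in> P \<Longrightarrow> \<exists>C\<in>Q. B \<subseteq> C"
    using assms(3) unfolding refines_def by blast+
  have fin: "finite P" "finite Q" using finite_elements[OF assms(1)] P Q by auto
  have neP: "B \<noteq> {}" if "B \<in> P" for B using P that unfolding partition_on_def by blast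
  have finQ: "finite C" if "C \<in> Q" for C
    using partition_onD1[OF Q] that assms(1) by (meson Sup_upper finite_subset)
  have parts: "partition_on C (parts C)" if "C \<in> Q" for C
    using refines_obtains_subset[OF assms(3) that] unfolding parts_def .
  have finparts: "finite (parts C)" for C using fin unfolding parts_def by simp
  have disj: "parts C \<inter> parts D = {}" if "C \<in> Q" "D \<in> Q" "C \<noteq> D" for C D
  proof -
    have "C \<inter> D = {}" using Q that unfolding partition_on_def disjoint_def by blast
    then show ?thesis using neP unfolding parts_def by fastforce
  qed
  have "P = \<Union>(parts ` Q)" using sub unfolding parts_def by blast
  then have cardP: "card P = (\<Sum>C\<in>Q. card (parts C))"
    using card_UN_disjoint[OF fin(2), of parts] finparts disj by auto
  have cong1: "[card (parts C) = 1] (mod d)" if "C \<in> Q" for C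
    using card_cong_card_partition[OF finQ[OF that] parts[OF that], of d] cP cQ[OF that]
    unfolding parts_def by (auto intro: cong_trans cong_sym)
  have pos: "1 \<le> card (parts C)" if "C \<in> Q" for C
  proof -
    have "C \<noteq> {}" using Q that unfolding partition_on_def by blast
    then have "parts C \<noteq> {}" using parts[OF that] unfolding partition_on_def by blast
    then show ?thesis using finparts by (simp add: Suc_le_eq card_gt_0_iff)
  qed
  have single: "parts C = {C}" if "C \<in> Q" "card (parts C) = 1" for C
    using that(2) partition_onD1[OF parts[OF that(1)]] by (metis card_1_singletonE cSup_singleton)
  have "\<exists>C\<in>Q. card (parts C) \<noteq> 1"
  proof (rule ccontr)
    assume "\<not> ?thesis"
    then have "parts C = {C}" if "C \<in> Q" for C using single that by blast
    then have "P = Q" using \<open>P = \<Union>(parts ` Q)\<close> by auto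
    then show False using assms(4) by simp
  qed
  then obtain C where C: "C \<in> Q" "card (parts C) \<noteq> 1" by blast
  have "d dvd card (parts C) - 1"
    using cong1[OF C(1)] pos[OF C(1)] cong_altdef_nat by blast
  moreover have "0 < card (parts C) - 1"
    using pos[OF C(1)] C(2) by linarith
  ultimately have big: "d + 1 \<le> card (parts C)"
    using dvd_imp_le[of d "card (parts C) - 1"] by linarith
  have split: "card P = card (parts C) + (\<Sum>D\<in>Q - {C}. card (parts D))"
    unfolding cardP using fin(2) C(1) by (rule sum.remove)
  have rest: "(\<Sum>D\<in>Q - {C}. 1) \<le> (\<Sum>D\<in>Q - {C}. card (parts D))"
    by (rule sum_mono) (use pos in auto)
  have cQC: "card Q = Suc (card (Q - {C}))" using card_Suc_Diff1[OF fin(2) C(1)] by simp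
  show "card Q + d \<le> card P" using split rest big cQC by simp
  assume eq: "card P = card Q + d"
  then have sums: "card (parts C) = d + 1" "(\<Sum>D\<in>Q - {C}. card (parts D)) = (\<Sum>D\<in>Q - {C}. 1)"
    using split rest big cQC by simp_all
  have one: "parts D = {D}" if "D \<in> Q" "D \<noteq> C" for D
  proof -
    have "1 = card (parts D)"
      by (rule sum_mono_inv[OF sums(2)[symmetric]]) (use that pos fin in auto)
    then show ?thesis using single that by simp
  qed
  have P_eq: "P = (Q - {C}) \<union> parts C"
  proof -
    have "parts ` (Q - {C}) = (\<lambda>D. {D}) ` (Q - {C})" using one by (intro image_cong) auto
    moreover have "\<Union>(parts ` Q) = parts C \<union> \<Union>(parts ` (Q - {C}))" using C(1) by blast
    ultimately show ?thesis using \<open>P = \<Union>(parts ` Q)\<close> by auto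
  qed
  \<comment> \<open>This makes the pieces of \<open>C\<close> exactly the members of
    \<open>P - Q\<close>, the set from which \<open>merged_blocks\<close> is formed.\<close>
  have "C \<notin> parts C"
  proof
    assume "C \<in> parts C"
    then have "B = C" if B: "B \<in> parts C" for B
    proof -
      obtain x where "x \<in> B" using B neP[of B] unfolding parts_def by blast
      then show ?thesis
        using partition_on_same_block[OF P, of B C x] B \<open>C \<in> parts C\<close> unfolding parts_def by blast
    qed
    then have "parts C = {C}" using \<open>C \<in> parts C\<close> by blast
    then show False using C(2) by simp
  qed
  then have "B \<notin> Q" if B: "B \<in> parts C" for B
  proof -
    obtain x where "x \<in> B" using B neP[of B] unfolding parts_def by blast
    then show ?thesis
      using partition_on_same_block[OF Q, of B C x] B C(1) \<open>C \<notin> parts C\<close> unfolding parts_def by blast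
  qed
  then have "P - Q = parts C" using P_eq by blast
  then show "\<exists>C\<in>Q. partition_on C (P - Q) \<and> card (P - Q) = d + 1 \<and> P = (Q - {C}) \<union> (P - Q)"
    using C(1) parts P_eq sums(1) by metis
qed

text \<open>The number of blocks inside a gap of \<open>B\<close> is divisible by \<open>d\<close>, and there are only \<open>d\<close>
  blocks other than \<open>B\<close>.\<close>

lemma gap_contains_all_blocks:
  assumes nc: "noncrossing P" and "F \<subseteq> P" and F: "partition_on C F" "card F = d + 1" and fin: "finite C"
    and gC: "unit_gaps d C" and gB: "unit_gaps d B" and card1: "\<And>E. E \<in> F \<Longrightarrow> [card E = 1] (mod d)"
    and B: "B \<in> F" "x \<in> B" "y \<in> B" "x < y" "B \<inter> {x<..<y} = {}"
    and C: "C \<inter> {x<..<y} \<noteq> {}"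
    and E: "E \<in> F" "E \<noteq> B"
  shows "E \<subseteq> {x<..<y}"
proof -
  define G where "G = {E \<in> F. E \<inter> {x<..<y} \<noteq> {}}"
  have CF: "C = \<Union>F" using F(1) unfolding partition_on_def by simp
  \<comment> \<open>A block meeting the gap cannot leave it without crossing
    \<open>B\<close>.\<close>
  have inside: "E \<subseteq> {x<..<y}" if "E \<in> G" for E
  proof
    fix u assume u: "u \<in> E"
    obtain w where w: "w \<in> E" "x < w" "w < y" and "E \<in> F" using \<open>E \<in> G\<close> unfolding G_def by auto
    have "E \<noteq> B" using B(5) w by auto
    then have "u \<noteq> x" "u \<noteq> y"
      using partition_on_same_block[OF F(1) \<open>E \<in> F\<close> B(1), of u] u B(2,3) by auto
    moreover have "\<not> u < x"
      using noncrossingD[OF nc, of E B u w x y] u w B \<open>E \<in> F\<close> \<open>E \<noteq> B\<close> assms(2) by auto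
    moreover have "\<not> y < u"
      using noncrossingD[OF nc, of B E x y w u] u w B \<open>E \<in> F\<close> \<open>E \<noteq> B\<close> assms(2) by auto
    ultimately show "u \<in> {x<..<y}" by simp
  qed
  have "partition_on (C \<inter> {x<..<y}) G"
  proof (rule partition_onI)
    show "\<Union>G = C \<inter> {x<..<y}" using inside unfolding CF G_def by blast
    show "disjnt p q" if "p \<in> G" "q \<in> G" "p \<noteq> q" for p q
      using that F(1) unfolding G_def partition_on_def disjoint_def disjnt_def by blast
    show "{} \<notin> G" unfolding G_def by blast
  qed
  then have "[card (C \<inter> {x<..<y}) = card G] (mod d)"
    using fin card1 by (intro card_cong_card_partition) (auto simp: G_def)
  \<comment> \<open>The difference \<open>y - x\<close> is counted twice: \<open>x\<close> and
    \<open>y\<close> are consecutive in \<open>B\<close>, while in \<open>C\<close> they are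
    separated by the points of the gap.\<close>
  moreover have "[card (C \<inter> {x<..<y}) = 0] (mod d)"
  proof -
    have xyC: "x \<in> C" "y \<in> C" using CF B(1-3) by auto
    have "C \<inter> {x<..y} = insert y (C \<inter> {x<..<y})" using xyC B(4) by auto
    then have "card (C \<inter> {x<..y}) = Suc (card (C \<inter> {x<..<y}))" using fin by simp
    then have "[y = (x + 1) + card (C \<inter> {x<..<y})] (mod d)"
      using unit_gaps_cong_card[OF gC xyC] B(4) by simp
    moreover have "[y = (x + 1) + 0] (mod d)"
      using gB B unfolding unit_gaps_def by simp
    ultimately show ?thesis
      by (metis cong_add_lcancel_nat cong_sym cong_trans)
  qed
  ultimately have "d dvd card G"
    by (metis cong_0_iff cong_sym cong_trans)
  moreover have "G \<noteq> {}" using C unfolding CF G_def by blast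
  moreover have finF: "finite F" using finite_elements[OF fin F(1)] .
  moreover have "G \<subseteq> F - {B}" using B(5) unfolding G_def by blast
  moreover have cF: "card (F - {B}) = d" using F(2) B(1) finF by simp
  ultimately have "card (F - {B}) \<le> card G"
    by (metis card_gt_0_iff dvd_imp_le finite_Diff finite_subset)
  then have "G = F - {B}"
    using card_seteq[of "F - {B}" G] finF \<open>G \<subseteq> F - {B}\<close> by simp
  then show ?thesis using inside E by blast
qed

text \<open>\<open>Min\<close> is injective on the blocks of one partition but not on all sets, so
  the sorting facts are instantiated relative to \<open>A\<close>.\<close>

lemma (in linorder) sorted_key_list_of_set_inj_on:
  assumes "inj_on f A" "finite A"
  shows "set (sorted_key_list_of_set f A) = A" "length (sorted_key_list_of_set f A) = card A"
    "sorted_wrt (<) (map f (sorted_key_list_of_set f A))"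
proof -
  interpret folding_insort_key "(\<le>)" "(<)" A f
    by unfold_locales (fact assms(1))
  show "set (sorted_key_list_of_set f A) = A" "length (sorted_key_list_of_set f A) = card A"
    "sorted_wrt (<) (map f (sorted_key_list_of_set f A))"
    using assms(2) by simp_all
qed

lemma sorted_blocks:
  assumes F: "partition_on C F" and "finite C" "card F = m" and bs: "bs = sorted_key_list_of_set Min F"
  shows "set bs = F" "length bs = m" "\<And>r s. r < s \<Longrightarrow> s < m \<Longrightarrow> Min (bs ! r) < Min (bs ! s)"
proof -
  have fin: "finite B" "B \<noteq> {}" if "B \<in> F" for B
    using F that assms(2) finite_subset[of B C] unfolding partition_on_def by auto
  have "inj_on Min F"
  proof (rule inj_onI)
    fix B D assume BD: "B \<in> F" "D \<in> F" "Min B = Min D"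
    then have "Min B \<in> B" "Min B \<in> D" using fin by (metis Min_in)+
    then show "B = D" using partition_on_same_block[OF F BD(1,2)] by blast
  qed
  note sorted = sorted_key_list_of_set_inj_on[OF this finite_elements[OF assms(2) F], folded bs]
  then show "set bs = F" "length bs = m" using assms(3) by simp_all
  then show "Min (bs ! r) < Min (bs ! s)" if "r < s" "s < m" for r s
    using sorted(3) that by (simp add: sorted_wrt_iff_nth_less)
qed

text \<open>If a gap of \<open>bs ! s\<close> with \<open>s > 0\<close> contained a point of
  \<open>C\<close>, it would contain all of \<open>bs ! 0\<close>, which has the smallest minimum;
  so these blocks are convex in \<open>C\<close>. A gap of \<open>bs ! 0\<close> that contains a
  point of another block contains all other blocks, so there is at most one such gap, and it begins
  at the label.\<close>

lemma interval_split_cover: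
  assumes "d \<ge> 1" and nc: "noncrossing P"
    and C: "C \<in> Q" "finite C" "partition_on C (P - Q)" "card (P - Q) = d + 1" "P = (Q - {C}) \<union> (P - Q)"
    and gC: "unit_gaps d C" and gB: "\<And>B. B \<in> P - Q \<Longrightarrow> unit_gaps d B"
    and card1: "\<And>E. E \<in> P - Q \<Longrightarrow> [card E = 1] (mod d)"
  shows "interval_split d (cover_label P Q) P Q"
proof -
  define bs where "bs = merged_blocks P Q"
  define a where "a = cover_label P Q"
  \<comment> \<open>The thresholds are the right ends of the intervals. \<open>t 0\<close> is the
    label and not \<open>Max (bs ! 0)\<close>, because \<open>bs ! 0\<close> may continue beyond the
    other blocks.\<close>
  define t where "t s = (if s = 0 then a else Max (bs ! s))" for s
  note bs = sorted_blocks[OF C(3,2,4), of bs, unfolded bs_def merged_blocks_def, OF refl,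
      folded merged_blocks_def, folded bs_def]
  have nth: "bs ! s \<in> P - Q" if "s \<le> d" for s using bs(1,2) that by (metis Suc_eq_plus1 le_imp_less_Suc nth_mem)
  have C_eq: "C = \<Union>(P - Q)" using C(3) unfolding partition_on_def by simp
  have fin: "finite (bs ! s)" and ne: "bs ! s \<noteq> {}" if "s \<le> d" for s
    using nth[OF that] C(2,3) finite_subset[of "bs ! s" C] unfolding partition_on_def by auto
  have minin: "Min (bs ! s) \<in> bs ! s" if "s \<le> d" for s using fin[OF that] ne[OF that] by simp
  have minle: "Min (bs ! s) \<le> x" if "s \<le> d" "x \<in> bs ! s" for s x using fin[OF that(1)] that by simp
  have maxge: "x \<le> Max (bs ! s)" if "s \<le> d" "x \<in> bs ! s" for s x using fin[OF that(1)] that by simp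
  have maxin: "Max (bs ! s) \<in> bs ! s" if "s \<le> d" for s using fin[OF that] ne[OF that] by simp
  have mins: "Min (bs ! r) < Min (bs ! s)" if "r < s" "s \<le> d" for r s using bs(3) that by simp
  have same: "r = s" if "x \<in> bs ! r" "x \<in> bs ! s" "r \<le> d" "s \<le> d" for x r s
  proof -
    have "bs ! r = bs ! s" using partition_on_same_block[OF C(3)] nth that by blast
    then show ?thesis using mins[of r s] mins[of s r] that by (metis less_irrefl linorder_neqE_nat)
  qed
  have ex: "\<exists>s\<le>d. x \<in> bs ! s" if "x \<in> C" for x
    using that bs(1,2) unfolding C_eq by (metis UnionE Suc_eq_plus1 in_set_conv_nth less_Suc_eq_le)
  have inC: "x \<in> C" if "x \<in> bs ! s" "s \<le> d" for x s using that nth C_eq by blast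
  have gap: "bs ! r \<subseteq> {x<..<y}"
    if "s \<le> d" "x \<in> bs ! s" "y \<in> bs ! s" "x < y" "bs ! s \<inter> {x<..<y} = {}" "z \<in> C" "x < z" "z < y" "r \<le> d" "r \<noteq> s"
    for r s x y z
  proof (rule gap_contains_all_blocks[OF nc _ C(3,4,2) gC gB[OF nth[OF that(1)]] card1 nth[OF that(1)] that(2-5) _ nth[OF that(9)]])
    show "bs ! r \<noteq> bs ! s" using same minin that(1,9,10) by metis
    show "C \<inter> {x<..<y} \<noteq> {}" using that(6-8) by auto
  qed auto
  \<comment> \<open>If \<open>z\<close> were missing, its neighbours \<open>u\<close> and
    \<open>v\<close> in \<open>bs ! s\<close> would bound a gap containing \<open>bs ! 0\<close>;
    then \<open>Min (bs ! 0)\<close> would exceed \<open>u\<close>, hence also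
    \<open>Min (bs ! s)\<close>.\<close>
  have convex: "z \<in> bs ! s" if s: "s \<le> d" "s \<noteq> 0" and xy: "x \<in> bs ! s" "y \<in> bs ! s" and z: "z \<in> C" "x < z" "z < y" for s x y z
  proof (rule ccontr)
    assume zn: "z \<notin> bs ! s"
    define u where "u = Max (bs ! s \<inter> {..<z})"
    define v where "v = Min (bs ! s \<inter> {z<..})"
    have u: "u \<in> bs ! s \<inter> {..<z}" unfolding u_def using xy z fin[OF s(1)] by (intro Max_in) auto
    have v: "v \<in> bs ! s \<inter> {z<..}" unfolding v_def using xy z fin[OF s(1)] by (intro Min_in) auto
    have "w \<le> u \<or> v \<le> w" if "w \<in> bs ! s" for w
    proof (cases "w < z")
      case True
      then show ?thesis using that fin[OF s(1)] unfolding u_def by simp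
    next
      case False
      then have "w > z" using zn that by (metis linorder_neqE_nat)
      then show ?thesis using that fin[OF s(1)] unfolding v_def by simp
    qed
    then have "bs ! s \<inter> {u<..<v} = {}" by fastforce
    then have "bs ! 0 \<subseteq> {u<..<v}" using gap[of s u v z 0] u v s z by auto
    then have "u < Min (bs ! 0)" using minin[of 0] by auto
    then show False using mins[of 0 s] minle[of s u] s u by simp
  qed
  have minmax: "Max (bs ! r) < Min (bs ! s)" if "1 \<le> r" "r < s" "s \<le> d" for r s
  proof (rule ccontr)
    assume "\<not> ?thesis"
    moreover have "Min (bs ! s) \<noteq> Max (bs ! r)" using same[of "Min (bs ! s)" r s] minin[of s] maxin[of r] that by auto
    ultimately have "Min (bs ! s) \<in> bs ! r"
      using convex[of r "Min (bs ! r)" "Max (bs ! r)" "Min (bs ! s)"] mins[of r s] minin[of r] maxin[of r] minin[of s]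
        inC[of "Min (bs ! s)" s] that by simp
    then show False using same[of "Min (bs ! s)" r s] minin[of s] that by simp
  qed
  \<comment> \<open>The set is nonempty, so the \<open>Max\<close> in \<open>cover_label\<close> is
    attained.\<close>
  have below: "finite {i \<in> bs ! 0. i < Min (bs ! 1)}" "Min (bs ! 0) \<in> {i \<in> bs ! 0. i < Min (bs ! 1)}"
    using minin[of 0] mins[of 0 1] assms(1) by auto
  have a: "a \<in> bs ! 0" "a < Min (bs ! 1)" and a_max: "\<And>x. x \<in> bs ! 0 \<Longrightarrow> x < Min (bs ! 1) \<Longrightarrow> x \<le> a"
  proof -
    have a_eq: "a = Max {i \<in> bs ! 0. i < Min (bs ! 1)}" unfolding a_def cover_label_def bs_def ..
    then have "a \<in> {i \<in> bs ! 0. i < Min (bs ! 1)}" using Max_in[OF below(1)] below(2) by blast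
    then show "a \<in> bs ! 0" "a < Min (bs ! 1)" by auto
    show "x \<le> a" if "x \<in> bs ! 0" "x < Min (bs ! 1)" for x
      unfolding a_eq by (rule Max_ge[OF below(1)]) (use that in simp)
  qed
  \<comment> \<open>The gap of \<open>bs ! 0\<close> right after the label contains
    \<open>Min (bs ! 1)\<close>, hence the whole of \<open>bs ! d\<close>; the next element of
    \<open>bs ! 0\<close> is therefore larger than \<open>t d\<close>.\<close>
  have first: "z \<notin> bs ! 0" if z: "a < z" "z \<le> t d" for z
  proof
    assume z0: "z \<in> bs ! 0"
    define y where "y = Min (bs ! 0 \<inter> {a<..})"
    have fy: "finite (bs ! 0 \<inter> {a<..})" using fin[of 0] by simp
    have y: "y \<in> bs ! 0 \<inter> {a<..}" unfolding y_def using z z0 fy by (intro Min_in) auto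
    have ymin: "y \<le> w" if "w \<in> bs ! 0" "a < w" for w using that fy unfolding y_def by simp
    have "Min (bs ! 1) \<noteq> y" using same[of y 0 1] minin[of 1] y assms(1) by auto
    moreover have "\<not> y < Min (bs ! 1)" using a_max[of y] y by auto
    ultimately have "Min (bs ! 1) < y" by linarith
    moreover have "bs ! 0 \<inter> {a<..<y} = {}" using ymin by fastforce
    moreover have "Min (bs ! 1) \<in> C" using inC minin[of 1] assms(1) by blast
    ultimately have "bs ! d \<subseteq> {a<..<y}" using gap[of 0 a y "Min (bs ! 1)" d] a y assms(1) by auto
    then have "Max (bs ! d) < y" using maxin[of d] by auto
    then show False using ymin[OF z0 z(1)] z(2) assms(1) unfolding t_def by simp
  qed
  have t_mono: "t s \<le> t (Suc s)" and t_min: "t s < Min (bs ! Suc s)" if "s < d" for s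
  proof -
    show "t s < Min (bs ! Suc s)"
      using a(2) minmax[of s "Suc s"] that unfolding t_def by (cases "s = 0") auto
    then show "t s \<le> t (Suc s)"
      using minle[of "Suc s" "Max (bs ! Suc s)"] maxin[of "Suc s"] that unfolding t_def by auto
  qed
  have t_mono': "t r \<le> t s" if "r \<le> s" "s \<le> d" for r s
    using that by (induction s rule: dec_induct) (use t_mono in \<open>auto intro: order_trans\<close>)
  have blk: "bs ! Suc s \<subseteq> {t s<..t (Suc s)}" if "s < d" for s
  proof
    fix x assume "x \<in> bs ! Suc s"
    then show "x \<in> {t s<..t (Suc s)}"
      using t_min[OF that] minle[of "Suc s" x] maxge[of "Suc s" x] that unfolding t_def by auto
  qed
  have B0: "bs ! 0 = C - {t 0<..t d}"
  proof (rule set_eqI)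
    fix x
    have "x \<in> bs ! 0" if x: "x \<in> C" "x \<notin> {t 0<..t d}"
    proof -
      obtain s where s: "s \<le> d" "x \<in> bs ! s" using ex x by blast
      have "s = 0"
      proof (rule ccontr)
        assume "s \<noteq> 0"
        then obtain r where r: "s = Suc r" "r < d" using s(1) by (cases s) auto
        then have "x \<in> {t r<..t (Suc r)}" using subsetD[OF blk[OF r(2)]] s(2) by simp
        then show False using x(2) t_mono'[of 0 r] t_mono'[of "Suc r" d] r by auto
      qed
      then show ?thesis using s by simp
    qed
    moreover have "x \<in> C \<and> x \<notin> {t 0<..t d}" if "x \<in> bs ! 0"
      using that inC[of x 0] first[of x] unfolding t_def by auto
    ultimately show "x \<in> bs ! 0 \<longleftrightarrow> x \<in> C - {t 0<..t d}" by blast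
  qed
  have Bs: "bs ! Suc s = C \<inter> {t s<..t (Suc s)}" if sd: "s < d" for s
  proof (rule set_eqI)
    fix x
    have "x \<in> bs ! Suc s" if x: "x \<in> C" "x \<in> {t s<..t (Suc s)}"
    proof -
      obtain r where r: "r \<le> d" "x \<in> bs ! r" using ex x by blast
      have "r \<noteq> 0"
        using r(2) x(2) B0 t_mono'[of 0 s] t_mono'[of "Suc s" d] sd by (cases "r = 0") auto
      then obtain q where q: "r = Suc q" "q < d" using r(1) by (cases r) auto
      then have "x \<in> {t q<..t (Suc q)}" using subsetD[OF blk[OF q(2)]] r(2) by simp
      then have "q = s"
        using x(2) t_mono'[of "Suc q" s] t_mono'[of "Suc s" q] sd q(2)
        by (cases q s rule: linorder_cases) auto
      then show ?thesis using q r by simp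
    qed
    then show "x \<in> bs ! Suc s \<longleftrightarrow> x \<in> C \<inter> {t s<..t (Suc s)}"
      using blk[OF sd] inC[of x "Suc s"] sd by auto
  qed
  have "P - Q = (!) bs ` {..<Suc d}" using bs(1,2) by (auto simp: set_conv_nth)
  also have "\<dots> = insert (bs ! 0) ((\<lambda>s. bs ! Suc s) ` {..<d})"
    by (simp add: lessThan_Suc_eq_insert_0 image_image)
  also have "\<dots> = insert (C - {t 0<..t d}) ((\<lambda>s. C \<inter> {t s<..t (Suc s)}) ` {..<d})"
    using B0 Bs by (auto intro!: image_cong)
  finally have "P = (Q - {C}) \<union> insert (C - {t 0<..t d}) ((\<lambda>s. C \<inter> {t s<..t (Suc s)}) ` {..<d})"
    using C(5) by simp
  moreover have "a \<in> C" using a(1) inC by blast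
  moreover have "t 0 = a" unfolding t_def by simp
  ultimately show ?thesis
    unfolding interval_split_def a_def[symmetric] using C(1) t_mono by blast
qed

text \<open>The \<open>k\<close> steps together remove \<open>d * k\<close> blocks and each removes
  at least \<open>d\<close>, so none can remove more. This equality case is what
  \<open>interval_split_cover\<close> needs.\<close>

lemma NCd_maximal_chain_interval_split:
  assumes d: "d \<ge> 1" and chain: "NCd_maximal_chain d k \<pi>" and "i < k"
  shows "interval_split d (cover_label (\<pi> i) (\<pi> (Suc i))) (\<pi> i) (\<pi> (Suc i))"
proof -
  define n where "n = d * k + 1"
  have \<pi>: "\<pi> i \<in> NCd d n" if "i \<le> k" for i
    using chain that unfolding NCd_maximal_chain_def n_def by auto
  have ref: "refines {1..n} (\<pi> i) (\<pi> (Suc i))" "\<pi> i \<noteq> \<pi> (Suc i)" if "i < k" for i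
    using chain that unfolding NCd_maximal_chain_def NCd_covers_def NCd_less_def n_def by auto
  have c1: "[card B = 1] (mod d)" if "i \<le> k" "B \<in> \<pi> i" for i B
    using \<pi>[OF that(1)] that(2) unfolding NCd_def by blast
  have step: "card (\<pi> (Suc i)) + d \<le> card (\<pi> i)" if "i < k" for i
  proof (rule refines_card_ge(1)[OF _ d ref[OF that]])
    show "[card B = 1] (mod d)" if "B \<in> \<pi> i" for B using c1[OF _ that] \<open>i < k\<close> by simp
    show "[card B = 1] (mod d)" if "B \<in> \<pi> (Suc i)" for B using c1[OF _ that] \<open>i < k\<close> by simp
  qed simp
  have up: "card (\<pi> i) + d * i \<le> n" if "i \<le> k" for i
    using that
  proof (induction i)
    case 0
    have "\<pi> 0 = (\<lambda>i. {i}) ` {1..n}" using chain unfolding NCd_maximal_chain_def n_def by auto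
    then show ?case by (simp add: card_image)
  next
    case (Suc i)
    then show ?case using step[of i] by simp
  qed
  have down: "1 + d * (k - i) \<le> card (\<pi> i)" if "i \<le> k" for i
    using that
  proof (induction rule: inc_induct)
    case base
    then show ?case using chain unfolding NCd_maximal_chain_def by simp
  next
    case (step j)
    then have "k - j = Suc (k - Suc j)" by simp
    then show ?case using step.IH \<open>\<And>i. i < k \<Longrightarrow> card (\<pi> (Suc i)) + d \<le> card (\<pi> i)\<close>[of j] step.hyps by simp
  qed
  have dk: "d * k = d * i + d * (k - i)" "d * (k - i) = d * (k - Suc i) + d"
    using \<open>i < k\<close> by (metis add_mult_distrib2 le_add_diff_inverse less_imp_le)
      (metis Suc_diff_Suc \<open>i < k\<close> add.commute mult_Suc_right)
  \<comment> \<open>The bounds \<open>up\<close> at \<open>i\<close> and \<open>down\<close> at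
    \<open>Suc i\<close> differ by exactly \<open>d\<close>, the least drop that \<open>step\<close>
    allows.\<close>
  have "card (\<pi> i) = card (\<pi> (Suc i)) + d"
    using up[of i] down[of "Suc i"] step[OF \<open>i < k\<close>] dk \<open>i < k\<close> unfolding n_def by linarith
  moreover have "[card B = 1] (mod d)" if "B \<in> \<pi> i" for B using c1[OF _ that] \<open>i < k\<close> by simp
  moreover have "[card B = 1] (mod d)" if "B \<in> \<pi> (Suc i)" for B using c1[OF _ that] \<open>i < k\<close> by simp
  ultimately obtain C where C: "C \<in> \<pi> (Suc i)" "partition_on C (\<pi> i - \<pi> (Suc i))" "card (\<pi> i - \<pi> (Suc i)) = d + 1"
      "\<pi> i = (\<pi> (Suc i) - {C}) \<union> (\<pi> i - \<pi> (Suc i))"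
    using refines_card_ge(2)[OF _ d ref[OF \<open>i < k\<close>]] by blast
  have "C \<subseteq> {1..n}" using \<pi>[of "Suc i"] C(1) \<open>i < k\<close> unfolding NCd_def partition_on_def by auto
  show ?thesis
  proof (rule interval_split_cover[OF d _ C(1) _ C(2,3,4)])
    show "noncrossing (\<pi> i)" using \<pi>[of i] \<open>i < k\<close> unfolding NCd_def by simp
    show "finite C" using \<open>C \<subseteq> {1..n}\<close> finite_subset by blast
    show "unit_gaps d C" using NCd_unit_gaps[OF \<pi>[of "Suc i"] C(1)] \<open>i < k\<close> by simp
    show "unit_gaps d B" if "B \<in> \<pi> i - \<pi> (Suc i)" for B
      using NCd_unit_gaps[OF \<pi>[of i]] that \<open>i < k\<close> by simp
    show "[card B = 1] (mod d)" if "B \<in> \<pi> i - \<pi> (Suc i)" for B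
      using c1[of i B] that \<open>i < k\<close> by simp
  qed
qed

subsection \<open>The labels determine the sequence of partitions\<close>

definition label_count :: "(nat \<Rightarrow> nat) \<Rightarrow> nat \<Rightarrow> nat set \<Rightarrow> nat" where
  "label_count a i X = card {j \<in> {1..i}. a j \<in> X}"

lemma label_count_Un: "X \<inter> Y = {} \<Longrightarrow> label_count a i (X \<union> Y) = label_count a i X + label_count a i Y"
  unfolding label_count_def by (subst card_Un_disjoint[symmetric]) (auto intro!: arg_cong[where f = card])

lemma label_count_Suc: "label_count a (Suc i) X = label_count a i X + (if a (Suc i) \<in> X then 1 else 0)"
proof -
  have "{j \<in> {1..Suc i}. a j \<in> X} =
      (if a (Suc i) \<in> X then insert (Suc i) {j \<in> {1..i}. a j \<in> X} else {j \<in> {1..i}. a j \<in> X})"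
    by (auto simp: le_Suc_eq)
  then show ?thesis unfolding label_count_def by simp
qed

text \<open>For \<open>m = 1\<close> and all \<open>x\<close> this says that the labels lying in \<open>X\<close> form a \<open>d\<close>-parking function
  relative to \<open>X\<close>; the parameter \<open>m\<close> makes the condition additive over disjoint unions.\<close>

definition prefix_bound :: "nat \<Rightarrow> (nat \<Rightarrow> nat) \<Rightarrow> nat \<Rightarrow> nat \<Rightarrow> nat set \<Rightarrow> nat \<Rightarrow> bool" where
  "prefix_bound d a i x X m \<longleftrightarrow>
     card (X \<inter> {..x}) + (if X \<subseteq> {..x} then 0 else 1) \<le> d * label_count a i (X \<inter> {..x}) + m"

text \<open>Sizes and label counts add up, and the term that marks a set reaching beyond
  \<open>x\<close> is subadditive.\<close>

lemma prefix_bound_Un: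
  assumes "X \<inter> Y = {}" "prefix_bound d a i x X m" "prefix_bound d a i x Y l"
  shows "prefix_bound d a i x (X \<union> Y) (m + l)"
proof -
  have "(X \<union> Y) \<inter> {..x} = (X \<inter> {..x}) \<union> (Y \<inter> {..x})" "(X \<inter> {..x}) \<inter> (Y \<inter> {..x}) = {}"
    using assms(1) by auto
  then have "label_count a i ((X \<union> Y) \<inter> {..x}) = label_count a i (X \<inter> {..x}) + label_count a i (Y \<inter> {..x})"
      "card ((X \<union> Y) \<inter> {..x}) = card (X \<inter> {..x}) + card (Y \<inter> {..x})"
    by (simp_all add: label_count_Un card_Un_disjoint)
  then show ?thesis
    using assms(2,3) unfolding prefix_bound_def by (auto simp: distrib_left split: if_splits)
qed

text \<open>Merging \<open>d + 1\<close> blocks leaves the sizes with a surplus of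
  \<open>d + 1\<close> over \<open>d\<close> times the labels; the new label pays for
  \<open>d\<close> of it. Only \<open>interval_split\<close> and the partition property are assumed,
  so that the lemma covers both the chain and the tree.\<close>

lemma label_count_block:
  assumes "finite A" and part: "\<And>i. i \<le> k \<Longrightarrow> partition_on A (P i)"
    and P0: "\<And>C. C \<in> P 0 \<Longrightarrow> \<exists>y. C = {y}"
    and split: "\<And>i. i < k \<Longrightarrow> interval_split d (a (Suc i)) (P i) (P (Suc i))"
    and "i \<le> k" "C \<in> P i"
  shows "card C = d * label_count a i C + 1 \<and> (\<forall>x. prefix_bound d a i x C 1)"
  using assms(5,6)
proof (induction i arbitrary: C)
  case 0
  then show ?case using P0[of C] by (auto simp: label_count_def prefix_bound_def)
next
  case (Suc i)
  obtain D t where D: "D \<in> P (Suc i)" "a (Suc i) \<in> D" "t 0 = a (Suc i)" "\<And>s. s < d \<Longrightarrow> t s \<le> t (Suc s)"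
    and Pi: "P i = (P (Suc i) - {D}) \<union> insert (D - {t 0<..t d}) ((\<lambda>s. D \<inter> {t s<..t (Suc s)}) ` {..<d})"
    using split[of i] Suc.prems unfolding interval_split_def by auto
  have IH: "card B = d * label_count a i B + 1" "prefix_bound d a i x B 1" if "B \<in> P i" for B x
    using Suc.IH[of B] Suc.prems that by auto
  show ?case
  proof (cases "C = D")
    case False
    then have "C \<in> P i" using Pi Suc.prems by blast
    moreover have "a (Suc i) \<notin> C"
      using partition_on_same_block[OF part[OF Suc.prems(1)] Suc.prems(2) D(1)] D(2) False by blast
    ultimately show ?thesis using IH by (simp add: label_count_Suc prefix_bound_def)
  next
    case True
    have finD: "finite D" using part[OF Suc.prems(1)] D(1) assms(1) partition_onD1 finite_subset
      by (metis Sup_upper)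
    have t0: "t 0 \<le> t s" if "s \<le> d" for s
      using that by (induction s) (use D(4) in \<open>auto intro: order_trans simp: Suc_le_eq\<close>)
    have Bs: "D \<inter> {t s<..t (Suc s)} \<in> P i" if "s < d" for s using Pi that by blast
    have B0: "D - {t 0<..t d} \<in> P i" using Pi by blast
    have U: "D \<inter> {t 0<..t (Suc s)} = (D \<inter> {t 0<..t s}) \<union> (D \<inter> {t s<..t (Suc s)})"
        "(D \<inter> {t 0<..t s}) \<inter> (D \<inter> {t s<..t (Suc s)}) = {}" if "s < d" for s
      using t0[of s] D(4)[OF that] that by auto
    \<comment> \<open>The intervals are joined one at a time, each contributing 1 to the surplus.
      They may not be collected as a set of blocks here, since their distinctness is not among the
      hypotheses.\<close>
    have "card (D \<inter> {t 0<..t s}) = d * label_count a i (D \<inter> {t 0<..t s}) + s \<and>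
        (\<forall>x. prefix_bound d a i x (D \<inter> {t 0<..t s}) s)" if "s \<le> d" for s
      using that
    proof (induction s)
      case 0
      then show ?case by (simp add: label_count_def prefix_bound_def)
    next
      case (Suc s)
      then have s: "s < d" by simp
      have "card (D \<inter> {t 0<..t (Suc s)}) = card (D \<inter> {t 0<..t s}) + card (D \<inter> {t s<..t (Suc s)})"
        unfolding U(1)[OF s] using U(2)[OF s] finD by (intro card_Un_disjoint) auto
      moreover have "label_count a i (D \<inter> {t 0<..t (Suc s)}) =
          label_count a i (D \<inter> {t 0<..t s}) + label_count a i (D \<inter> {t s<..t (Suc s)})"
        unfolding U(1)[OF s] using U(2)[OF s] by (rule label_count_Un)
      moreover have "prefix_bound d a i x (D \<inter> {t 0<..t (Suc s)}) (s + 1)" for x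
        unfolding U(1)[OF s]
        by (rule prefix_bound_Un[OF U(2)[OF s] _ IH(2)[OF Bs[OF s]]]) (use Suc.IH s in simp)
      ultimately show ?case using Suc.IH IH(1)[OF Bs[OF s]] s by (simp add: distrib_left)
    qed
    from this[of d] have tail: "card (D \<inter> {t 0<..t d}) = d * label_count a i (D \<inter> {t 0<..t d}) + d"
        "\<And>x. prefix_bound d a i x (D \<inter> {t 0<..t d}) d" by auto
    have UD: "D = (D - {t 0<..t d}) \<union> (D \<inter> {t 0<..t d})"
        "(D - {t 0<..t d}) \<inter> (D \<inter> {t 0<..t d}) = {}" by auto
    have "card D = card (D - {t 0<..t d}) + card (D \<inter> {t 0<..t d})"
      by (subst UD(1), rule card_Un_disjoint) (use finD in auto)
    moreover have "label_count a i D =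
        label_count a i (D - {t 0<..t d}) + label_count a i (D \<inter> {t 0<..t d})"
      by (subst UD(1), rule label_count_Un) auto
    ultimately have "card D = d * label_count a (Suc i) D + 1"
      using IH(1)[OF B0] tail(1) D(2) by (simp add: label_count_Suc distrib_left)
    moreover have "prefix_bound d a (Suc i) x D 1" for x
    proof (cases "a (Suc i) \<le> x")
      case True
      \<comment> \<open>If the new label is at most \<open>x\<close>, it absorbs the
        \<open>d\<close> extra units.\<close>
      have "prefix_bound d a i x D (1 + d)"
        by (subst UD(1), rule prefix_bound_Un[OF UD(2) IH(2)[OF B0] tail(2)])
      then show ?thesis using True D(2) by (simp add: prefix_bound_def label_count_Suc)
    next
      case False
      \<comment> \<open>If the new label exceeds \<open>x\<close>, all intervals lie beyond
        \<open>x\<close>, and the remaining block, which contains the label, decides the bound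
        alone.\<close>
      then have "D \<inter> {..x} = (D - {t 0<..t d}) \<inter> {..x}" "\<not> D \<subseteq> {..x}" "\<not> D - {t 0<..t d} \<subseteq> {..x}"
        using D(2,3) by auto
      then show ?thesis using IH(2)[OF B0, of x] False by (simp add: prefix_bound_def label_count_Suc)
    qed
    ultimately show ?thesis using True by simp
  qed
qed

text \<open>The label lies in one block of \<open>Q\<close>, so both splittings cut the same
  \<open>C\<close>. Their intervals are compared from left to right: equal starts force equal
  ends.\<close>

lemma interval_split_unique:
  assumes Q: "partition_on A Q" and split: "interval_split d a P Q" "interval_split d a P' Q"
    and count: "\<And>B. B \<in> P \<Longrightarrow> card B = d * label_count b i B + 1 \<and> (\<forall>x. prefix_bound d b i x B 1)"
    and count': "\<And>B. B \<in> P' \<Longrightarrow> card B = d * label_count b i B + 1 \<and> (\<forall>x. prefix_bound d b i x B 1)"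
  shows "P = P'"
proof -
  obtain C t where C: "C \<in> Q" "a \<in> C" "t 0 = a" "\<And>s. s < d \<Longrightarrow> t s \<le> t (Suc s)"
    and P: "P = (Q - {C}) \<union> insert (C - {t 0<..t d}) ((\<lambda>s. C \<inter> {t s<..t (Suc s)}) ` {..<d})"
    using split(1) unfolding interval_split_def by auto
  obtain C' u where C': "C' \<in> Q" "a \<in> C'" "u 0 = a" "\<And>s. s < d \<Longrightarrow> u s \<le> u (Suc s)"
    and P': "P' = (Q - {C'}) \<union> insert (C' - {u 0<..u d}) ((\<lambda>s. C' \<inter> {u s<..u (Suc s)}) ` {..<d})"
    using split(2) unfolding interval_split_def by auto
  have "C' = C" using partition_on_same_block[OF Q C'(1) C(1) C'(2) C(2)] .
  note C' = C'[unfolded this] and P' = P'[unfolded this]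
  have le: "a \<le> v s" if "v 0 = a" "\<And>s. s < d \<Longrightarrow> v s \<le> v (Suc s)" "s \<le> d" for v :: "nat \<Rightarrow> nat" and s
    using that(3) by (induction s) (use that(1,2) in \<open>auto intro: order_trans simp: Suc_le_eq\<close>)
  \<comment> \<open>A proper initial part \<open>D\<close> of \<open>D'\<close> has at most
    \<open>d\<close> times its label count many elements by the bound for \<open>D'\<close>, one
    fewer than its own size formula requires.\<close>
  have shorter: "D = D'" if "card D = d * label_count b i D + 1" "prefix_bound d b i x D' 1" "D = D' \<inter> {..x}" for D D' x
  proof (rule ccontr)
    assume "D \<noteq> D'"
    then have "\<not> D' \<subseteq> {..x}" using that(3) by blast
    then show False using that unfolding prefix_bound_def by simp
  qed
  have eq: "C \<inter> {t s<..t (Suc s)} = C \<inter> {u s<..u (Suc s)}"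
    if "s < d" "C \<inter> {a<..t s} = C \<inter> {a<..u s}" for s
  proof -
    \<comment> \<open>The thresholds need not agree as numbers, only in how they cut
      \<open>C\<close>.\<close>
    have above: "x \<in> C \<Longrightarrow> t s < x \<longleftrightarrow> u s < x" for x
      using that(2) le[of t s] le[of u s] C(3,4) C'(3,4) that(1)
      by (metis IntE IntI greaterThanAtMost_iff le_less_trans less_imp_le not_le)
    have D: "C \<inter> {t s<..t (Suc s)} \<in> P" "C \<inter> {u s<..u (Suc s)} \<in> P'" using P P' that(1) by blast+
    show ?thesis
    proof (cases "t (Suc s) \<le> u (Suc s)")
      case True
      then have "C \<inter> {t s<..t (Suc s)} = (C \<inter> {u s<..u (Suc s)}) \<inter> {..t (Suc s)}" using above by auto
      then show ?thesis using shorter count[OF D(1)] count'[OF D(2)] by blast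
    next
      case False
      then have "C \<inter> {u s<..u (Suc s)} = (C \<inter> {t s<..t (Suc s)}) \<inter> {..u (Suc s)}" using above by auto
      then show ?thesis using shorter count[OF D(1)] count'[OF D(2)] by blast
    qed
  qed
  have tail: "C \<inter> {a<..t s} = C \<inter> {a<..u s}" if "s \<le> d" for s
    using that
  proof (induction s)
    case (Suc s)
    have "C \<inter> {a<..v (Suc s)} = (C \<inter> {a<..v s}) \<union> (C \<inter> {v s<..v (Suc s)})"
      if "a \<le> v s" "v s \<le> v (Suc s)" for v :: "nat \<Rightarrow> nat"
      using that by auto
    from this[of t] this[of u] show ?case
      using eq[of s] Suc le[of t s, OF C(3,4)] le[of u s, OF C'(3,4)] C(4)[of s] C'(4)[of s]
      by (simp add: Suc_le_eq)
  qed (simp add: C(3) C'(3))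
  have "C - {t 0<..t d} = C - {u 0<..u d}"
  proof -
    have "C - X = C - Y" if "C \<inter> X = C \<inter> Y" for X Y using that by blast
    then show ?thesis unfolding C(3) C'(3) using tail[OF le_refl] .
  qed
  moreover have "(\<lambda>s. C \<inter> {t s<..t (Suc s)}) ` {..<d} = (\<lambda>s. C \<inter> {u s<..u (Suc s)}) ` {..<d}"
    by (rule image_cong) (use eq tail in simp_all)
  ultimately show ?thesis by (simp only: P P')
qed

lemma interval_split_sequence_unique:
  assumes "finite A" and part: "\<And>i. i \<le> k \<Longrightarrow> partition_on A (P i)" "\<And>i. i \<le> k \<Longrightarrow> partition_on A (P' i)"
    and P0: "\<And>C. C \<in> P 0 \<Longrightarrow> \<exists>y. C = {y}" "\<And>C. C \<in> P' 0 \<Longrightarrow> \<exists>y. C = {y}" and "P k = P' k"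
    and split: "\<And>i. i < k \<Longrightarrow> interval_split d (a (Suc i)) (P i) (P (Suc i))"
      "\<And>i. i < k \<Longrightarrow> interval_split d (a (Suc i)) (P' i) (P' (Suc i))"
    and "i \<le> k"
  shows "P i = P' i"
  using assms(9)
proof (induction rule: inc_induct)
  case base
  then show ?case using assms(6) .
next
  case (step j)
  have count: "card B = d * label_count a j B + 1 \<and> (\<forall>x. prefix_bound d a j x B 1)" if "B \<in> P j" for B
    using label_count_block[where P = P and a = a, OF assms(1) part(1) P0(1) split(1), of k j B] step.hyps that by simp
  have count': "card B = d * label_count a j B + 1 \<and> (\<forall>x. prefix_bound d a j x B 1)" if "B \<in> P' j" for B
    using label_count_block[where P = P' and a = a, OF assms(1) part(2) P0(2) split(2), of k j B] step.hyps that by simp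
  show ?case
    using interval_split_unique[OF part(1)[of "Suc j"] split(1)[of j], of "P' j" a j]
      count count' split(2)[of j] step by simp
qed

subsection \<open>Subtrees and preorder\<close>

lemma rlabel_in_preorder: "rlabel t \<in> set (preorder t)"
  by (cases t) simp

lemma preorder_Node: "preorder t = rlabel t # concat (map preorder (subtrees t))"
  by (cases t) simp

lemma nodes_refl: "t \<in> nodes t"
  by (cases t) simp

text \<open>Subtrees are contiguous factors of the preorder list; this is why they become intervals
  under \<open>dfs\<close>.\<close>

lemma preorder_subtree: "S \<in> nodes T \<Longrightarrow> \<exists>xs ys. preorder T = xs @ preorder S @ ys"
proof (induction T)
  case (Node a ts)
  show ?case
  proof (cases "S = Node a ts")
    case True
    then show ?thesis by (metis append.left_neutral append.right_neutral)
  next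
    case False
    then obtain t where t: "t \<in> set ts" "S \<in> nodes t" using Node.prems by auto
    then obtain xs ys where "preorder t = xs @ preorder S @ ys" using Node.IH by blast
    moreover obtain us vs where "ts = us @ t # vs" using t(1) by (meson split_list)
    ultimately have "preorder (Node a ts) =
        (a # concat (map preorder us) @ xs) @ preorder S @ (ys @ concat (map preorder vs))" by simp
    then show ?thesis by blast
  qed
qed

lemma set_preorder_subtree: "S \<in> nodes T \<Longrightarrow> set (preorder S) \<subseteq> set (preorder T)"
  using preorder_subtree[of S T] by auto

lemma nodes_trans: "S \<in> nodes T \<Longrightarrow> R \<in> nodes S \<Longrightarrow> R \<in> nodes T"
  by (induction T) auto

lemma subtrees_nodes: "c \<in> set (subtrees S) \<Longrightarrow> c \<in> nodes S"
  by (cases S) (auto intro: nodes_refl)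

lemma distinct_preorder_subtree: "distinct (preorder T) \<Longrightarrow> S \<in> nodes T \<Longrightarrow> distinct (preorder S)"
  using preorder_subtree[of S T] by auto

section \<open>Edges of a tree and the vertex sets of its subtrees\<close>

lemma parent_edges_Node:
  "parent_edges (Node a ts) = {(a, rlabel t) | t. t \<in> set ts} \<union> (\<Union>t\<in>set ts. parent_edges t)"
proof (intro equalityI subrelI)
  fix q c assume "(q, c) \<in> parent_edges (Node a ts)"
  then obtain S where "S \<in> nodes (Node a ts)" "q = rlabel S" "c \<in> set (child_labels S)"
    unfolding parent_edges_def by blast
  then show "(q, c) \<in> {(a, rlabel t) | t. t \<in> set ts} \<union> (\<Union>t\<in>set ts. parent_edges t)"
    unfolding parent_edges_def by (auto simp: child_labels_def)
next
  fix q c assume "(q, c) \<in> {(a, rlabel t) | t. t \<in> set ts} \<union> (\<Union>t\<in>set ts. parent_edges t)"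
  then consider t where "q = a" "c = rlabel t" "t \<in> set ts"
    | t S where "t \<in> set ts" "S \<in> nodes t" "q = rlabel S" "c \<in> set (child_labels S)"
    unfolding parent_edges_def by blast
  then show "(q, c) \<in> parent_edges (Node a ts)"
  proof cases
    case 1
    then have "c \<in> set (child_labels (Node a ts))" by (simp add: child_labels_def)
    then show ?thesis using 1 nodes_refl[of "Node a ts"] unfolding parent_edges_def by force
  next
    case 2
    then have "S \<in> nodes (Node a ts)" by auto
    then show ?thesis using 2 unfolding parent_edges_def by blast
  qed
qed

lemma parent_edges_in_preorder:
  assumes "(q, c) \<in> parent_edges T"
  shows "q \<in> set (preorder T)" "c \<in> set (preorder T)"
proof -
  obtain S where S: "S \<in> nodes T" "q = rlabel S" "c \<in> set (child_labels S)"
    using assms unfolding parent_edges_def by blast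
  obtain t where "t \<in> set (subtrees S)" "c = rlabel t" using S(3) unfolding child_labels_def by auto
  then have "c \<in> set (preorder S)"
    using rlabel_in_preorder[of t] set_preorder_subtree[OF subtrees_nodes] by blast
  then show "q \<in> set (preorder T)" "c \<in> set (preorder T)"
    using S rlabel_in_preorder[of S] set_preorder_subtree[OF S(1)] by auto
qed

lemma preorder_Node_disjoint:
  assumes "distinct (preorder (Node a ts))" "t \<in> set ts" "t' \<in> set ts" "x \<in> set (preorder t)"
  shows "x \<noteq> a" "x \<in> set (preorder t') \<Longrightarrow> t' = t"
proof -
  show "x \<noteq> a" using assms by auto
  assume x: "x \<in> set (preorder t')"
  show "t' = t"
  proof (rule ccontr)
    assume "t' \<noteq> t"
    obtain us vs where ts: "ts = us @ t # vs" using assms(2) by (meson split_list)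
    then have "t' \<in> set us \<union> set vs" using assms(3) \<open>t' \<noteq> t\<close> by auto
    then show False using assms(1,4) x unfolding ts by auto
  qed
qed

text \<open>The only edge leaving the vertex set of \<open>S\<close> is the one above its root.
  Hence an edge set that omits this edge cannot connect the subtree with the rest of the
  tree.\<close>

lemma parent_edge_closed:
  assumes "distinct (preorder T)" "(q, c) \<in> parent_edges T" "S \<in> nodes T" "c \<noteq> rlabel S"
  shows "c \<in> set (preorder S) \<longleftrightarrow> q \<in> set (preorder S)"
  using assms
proof (induction T)
  case (Node a ts)
  note disj = preorder_Node_disjoint[OF Node.prems(1)]
  show ?case
  proof (cases "S = Node a ts")
    case True
    then show ?thesis using parent_edges_in_preorder[OF Node.prems(2)] by simp
  next
    case False
    then obtain t where t: "t \<in> set ts" "S \<in> nodes t" using Node.prems(3) by auto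
    have dt: "distinct (preorder t)"
      using distinct_preorder_subtree[OF Node.prems(1)] t(1) nodes_refl[of t] by auto
    have St: "set (preorder S) \<subseteq> set (preorder t)" using set_preorder_subtree[OF t(2)] .
    from Node.prems(2) consider t' where "q = a" "c = rlabel t'" "t' \<in> set ts"
      | t' where "t' \<in> set ts" "(q, c) \<in> parent_edges t'"
      unfolding parent_edges_Node by blast
    then show ?thesis
    proof cases
      case 1
      have "q \<notin> set (preorder S)" using disj(1)[OF t(1) t(1)] St 1(1) by blast
      moreover have "c \<notin> set (preorder S)"
      proof
        assume c: "c \<in> set (preorder S)"
        then have "t' = t" using disj(2)[OF t(1) 1(3)] St rlabel_in_preorder[of t'] 1(2) by blast
        obtain xs ys where pt: "preorder t = xs @ preorder S @ ys" using preorder_subtree[OF t(2)] by blast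
        \<comment> \<open>\<open>c\<close> heads the preorder of \<open>t\<close>; with distinct
          labels, a factor containing \<open>c\<close> must start there, which makes
          \<open>c\<close> the root of \<open>S\<close>.\<close>
        have "xs = []"
        proof (rule ccontr)
          assume "xs \<noteq> []"
          then have "c \<in> set xs" using pt 1(2) \<open>t' = t\<close> preorder_Node[of t] by (cases xs) auto
          then show False using c dt pt by auto
        qed
        then have "rlabel S = rlabel t" using pt preorder_Node[of t] preorder_Node[of S] by simp
        then show False using Node.prems(4) 1(2) \<open>t' = t\<close> by simp
      qed
      ultimately show ?thesis by simp
    next
      case 2
      show ?thesis
      proof (cases "t' = t")
        case True
        then show ?thesis using Node.IH[OF t(1) dt _ t(2) Node.prems(4)] 2(2) by simp
      next
        case False
        then have "q \<notin> set (preorder t)" "c \<notin> set (preorder t)"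
          using disj(2)[OF t(1) 2(1)] parent_edges_in_preorder[OF 2(2)] by blast+
        then show ?thesis using St by blast
      qed
    qed
  qed
qed

lemma root_not_child:
  assumes "distinct (preorder T)" "(q, c) \<in> parent_edges T"
  shows "c \<noteq> rlabel T"
proof -
  obtain a ts where T: "T = Node a ts" by (cases T)
  from assms(2) consider t where "c = rlabel t" "t \<in> set ts" | t where "t \<in> set ts" "(q, c) \<in> parent_edges t"
    unfolding T parent_edges_Node by blast
  then obtain t where "t \<in> set ts" "c \<in> set (preorder t)"
    using rlabel_in_preorder parent_edges_in_preorder by metis
  then show ?thesis using assms(1) unfolding T by auto
qed

text \<open>This determines the definite descriptions in \<open>parent\<close> and
  \<open>common_parent\<close>.\<close>

lemma parent_edges_unique:
  assumes "distinct (preorder T)" "(q, c) \<in> parent_edges T" "(q', c) \<in> parent_edges T"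
  shows "q' = q"
  using assms
proof (induction T)
  case (Node a ts)
  note disj = preorder_Node_disjoint[OF Node.prems(1)]
  have cases: "\<exists>t\<in>set ts. (p = a \<and> c = rlabel t) \<or> (p, c) \<in> parent_edges t"
    if "(p, c) \<in> parent_edges (Node a ts)" for p
    using that unfolding parent_edges_Node by blast
  have c: "c \<in> set (preorder t)" if "(p = a \<and> c = rlabel t) \<or> (p, c) \<in> parent_edges t" for p t
    using that rlabel_in_preorder[of t] parent_edges_in_preorder[of p c t] by blast
  obtain t where t: "t \<in> set ts" "(q = a \<and> c = rlabel t) \<or> (q, c) \<in> parent_edges t"
    using cases Node.prems(2) by blast
  obtain t' where t': "t' \<in> set ts" "(q' = a \<and> c = rlabel t') \<or> (q', c) \<in> parent_edges t'"
    using cases Node.prems(3) by blast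
  have "t' = t" using disj(2)[OF t(1) t'(1)] c[OF t(2)] c[OF t'(2)] by blast
  moreover have "distinct (preorder t)"
    using distinct_preorder_subtree[OF Node.prems(1)] t(1) nodes_refl[of t] by auto
  ultimately show ?case
    using t t' root_not_child[of t] Node.IH[OF t(1)] by blast
qed

lemma parent_eq: "distinct (preorder T) \<Longrightarrow> (q, c) \<in> parent_edges T \<Longrightarrow> parent T c = q"
  unfolding parent_def by (blast intro: parent_edges_unique)

lemma root_reaches: "v \<in> set (preorder T) \<Longrightarrow> (rlabel T, v) \<in> (parent_edges T)\<^sup>*"
proof (induction T)
  case (Node a ts)
  show ?case
  proof (cases "v = a")
    case False
    then obtain t where t: "t \<in> set ts" "v \<in> set (preorder t)" using Node.prems by auto
    have "parent_edges t \<subseteq> parent_edges (Node a ts)" "(a, rlabel t) \<in> parent_edges (Node a ts)"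
      unfolding parent_edges_Node using t(1) by blast+
    then show ?thesis
      using Node.IH[OF t] rtrancl_mono by (metis converse_rtrancl_into_rtrancl ptree.sel(1) subsetD)
  qed simp
qed

section \<open>Positions in the preorder listing\<close>

lemma dfs_eq:
  assumes "distinct (preorder T)" "preorder T = xs @ v # ys"
  shows "dfs T v = length xs + 1"
proof -
  have "v \<notin> set xs" using assms by auto
  then have "takeWhile (\<lambda>u. u \<noteq> v) (xs @ v # ys) = xs"
    by (subst takeWhile_append2) auto
  then show ?thesis unfolding dfs_def assms(2) by simp
qed

text \<open>Positions count from 1, so the factor after \<open>xs\<close> occupies the positions
  above \<open>length xs\<close>, a half-open interval as in \<open>interval_split\<close>.\<close>

lemma dfs_interval:
  assumes "distinct (preorder T)" "preorder T = xs @ ys @ zs" "v \<in> set (preorder T)"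
  shows "v \<in> set ys \<longleftrightarrow> length xs < dfs T v \<and> dfs T v \<le> length xs + length ys"
proof -
  consider "v \<in> set xs" | "v \<in> set ys" | "v \<in> set zs" using assms(2,3) by auto
  then show ?thesis
  proof cases
    case 1
    then obtain us vs where "xs = us @ v # vs" by (meson split_list)
    then show ?thesis using dfs_eq[of T us v "vs @ ys @ zs"] assms by auto
  next
    case 2
    then obtain us vs where "ys = us @ v # vs" by (meson split_list)
    then show ?thesis using dfs_eq[of T "xs @ us" v "vs @ zs"] assms by auto
  next
    case 3
    then obtain us vs where "zs = us @ v # vs" by (meson split_list)
    then show ?thesis using dfs_eq[of T "xs @ ys @ us" v vs] assms by auto
  qed
qed

lemma bij_betw_dfs:
  assumes "distinct (preorder T)"
  shows "bij_betw (dfs T) (set (preorder T)) {1..length (preorder T)}"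
proof -
  have inj: "inj_on (dfs T) (set (preorder T))"
  proof (rule inj_onI)
    fix u v assume u: "u \<in> set (preorder T)" and v: "v \<in> set (preorder T)" and eq: "dfs T u = dfs T v"
    obtain xs ys where split: "preorder T = xs @ u # ys" using u by (meson split_list)
    then have "v \<in> set [u]"
      using dfs_interval[OF assms, of xs "[u]" ys v] dfs_eq[OF assms split] v eq by simp
    then show "u = v" by simp
  qed
  have "dfs T ` set (preorder T) \<subseteq> {1..length (preorder T)}"
    using dfs_interval[OF assms, of "[]" "preorder T" "[]"] by fastforce
  moreover have "card (dfs T ` set (preorder T)) = length (preorder T)"
    using card_image[OF inj] distinct_card[OF assms] by simp
  ultimately have "dfs T ` set (preorder T) = {1..length (preorder T)}"
    by (intro card_subset_eq) auto
  then show ?thesis using inj unfolding bij_betw_def by simp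
qed

subsection \<open>Connected components\<close>

definition component :: "'a set \<Rightarrow> ('a \<times> 'a) set \<Rightarrow> 'a \<Rightarrow> 'a set" where
  "component V E u = {v \<in> V. (u, v) \<in> (E \<union> E\<inverse>)\<^sup>*}"

lemma components_eq: "components V E = component V E ` V"
  unfolding components_def quotient_def component_def by auto

lemma conn_sym: "(u, v) \<in> (E \<union> E\<inverse>)\<^sup>* \<Longrightarrow> (v, u) \<in> (E \<union> E\<inverse>)\<^sup>*"
  by (meson sym_Un_converse sym_rtrancl symE)

lemma component_cong:
  assumes "(u, v) \<in> (E \<union> E\<inverse>)\<^sup>*"
  shows "component V E u = component V E v"
proof -
  have "(u, w) \<in> (E \<union> E\<inverse>)\<^sup>* \<longleftrightarrow> (v, w) \<in> (E \<union> E\<inverse>)\<^sup>*" for w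
    using rtrancl_trans[OF assms, of w] rtrancl_trans[OF conn_sym[OF assms], of w] by argo
  then show ?thesis unfolding component_def by simp
qed

lemma partition_on_components: "partition_on V (components V E)"
proof -
  have "equiv V {(u, v). u \<in> V \<and> v \<in> V \<and> (u, v) \<in> (E \<union> E\<inverse>)\<^sup>*}"
    by (intro equivI refl_onI symI transI) (auto intro: conn_sym rtrancl_trans)
  then show ?thesis unfolding components_def by (rule partition_on_quotient)
qed

lemma conn_closed:
  assumes "(u, v) \<in> (E \<union> E\<inverse>)\<^sup>*" "\<And>q c. (q, c) \<in> E \<Longrightarrow> q \<in> X \<longleftrightarrow> c \<in> X"
  shows "u \<in> X \<longleftrightarrow> v \<in> X"
  using assms(1)
proof induction
  case (step y z)
  have "y \<in> X \<longleftrightarrow> z \<in> X" using step.hyps(2) assms(2)[of y z] assms(2)[of z y] by blast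
  then show ?case using step.IH by simp
qed simp

text \<open>After the star around \<open>p\<close> is deleted, every vertex of \<open>C\<close>
  still reaches the centre or a leaf, and the sets \<open>X s\<close> keep these apart. The
  \<open>X s\<close> are arbitrary closed sets rather than components so that they can be chosen as
  subtrees, which are preorder intervals.\<close>

lemma components_remove_star:
  fixes r :: "nat \<Rightarrow> 'a" and X :: "nat \<Rightarrow> 'a set"
  assumes "p \<in> V" "r ` {..<d} \<subseteq> V"
    and closed: "\<And>s q c. s < d \<Longrightarrow> (q, c) \<in> E \<Longrightarrow> q \<in> X s \<longleftrightarrow> c \<in> X s"
    and X: "\<And>s. s < d \<Longrightarrow> r s \<in> X s" "\<And>s. s < d \<Longrightarrow> p \<notin> X s"
      "\<And>s s'. s < d \<Longrightarrow> s' < d \<Longrightarrow> r s' \<in> X s \<Longrightarrow> s' = s"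
  defines "E' \<equiv> E \<union> {p} \<times> r ` {..<d}"
  defines "C \<equiv> component V E' p"
  shows "components V E =
    (components V E' - {C}) \<union> insert (C - (\<Union>s<d. X s)) ((\<lambda>s. C \<inter> X s) ` {..<d})"
proof -
  let ?W = "insert p (r ` {..<d})"
  have mono: "(u, v) \<in> (E' \<union> E'\<inverse>)\<^sup>*" if "(u, v) \<in> (E \<union> E\<inverse>)\<^sup>*" for u v
  proof -
    have "E \<union> E\<inverse> \<subseteq> E' \<union> E'\<inverse>" unfolding E'_def by blast
    then show ?thesis using rtrancl_mono that by blast
  qed
  have W: "(p, w) \<in> (E' \<union> E'\<inverse>)\<^sup>*" if "w \<in> ?W" for w
    using that unfolding E'_def by auto
  \<comment> \<open>A path either avoids the star edges, or its parts before the first and after the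
    last of them connect both ends to the star within \<open>E\<close>.\<close>
  have key: "(u, v) \<in> (E \<union> E\<inverse>)\<^sup>* \<or>
      (\<exists>w\<in>?W. (u, w) \<in> (E \<union> E\<inverse>)\<^sup>*) \<and> (\<exists>w\<in>?W. (v, w) \<in> (E \<union> E\<inverse>)\<^sup>*)"
    if "(u, v) \<in> (E' \<union> E'\<inverse>)\<^sup>*" for u v
    using that
  proof induction
    case (step y z)
    show ?case
    proof (cases "(y, z) \<in> E \<union> E\<inverse>")
      case True
      then have yz: "(y, z) \<in> (E \<union> E\<inverse>)\<^sup>*" "(z, y) \<in> (E \<union> E\<inverse>)\<^sup>*" by auto
      from step.IH show ?thesis
      proof (elim disjE conjE bexE)
        assume "(u, y) \<in> (E \<union> E\<inverse>)\<^sup>*"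
        then show ?thesis using rtrancl_trans[OF _ yz(1)] by blast
      next
        fix w w' assume "w \<in> ?W" "(u, w) \<in> (E \<union> E\<inverse>)\<^sup>*" "w' \<in> ?W" "(y, w') \<in> (E \<union> E\<inverse>)\<^sup>*"
        then show ?thesis using rtrancl_trans[OF yz(2)] by blast
      qed
    next
      case False
      then have "y \<in> ?W" "z \<in> ?W" using step.hyps(2) unfolding E'_def by auto
      moreover have "(z, z) \<in> (E \<union> E\<inverse>)\<^sup>*" by simp
      ultimately show ?thesis using step.IH by blast
    qed
  qed simp
  have C_W: "\<exists>w\<in>?W. (v, w) \<in> (E \<union> E\<inverse>)\<^sup>*" if "v \<in> C" for v
    using key[of p v] that conn_sym[of p v E] unfolding C_def component_def by blast
  have C_iff: "v \<in> C \<longleftrightarrow> v \<in> V \<and> (p, v) \<in> (E' \<union> E'\<inverse>)\<^sup>*" for v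
    unfolding C_def component_def by simp
  have in_C: "v \<in> C" if "w \<in> ?W" "(w, v) \<in> (E \<union> E\<inverse>)\<^sup>*" "v \<in> V" for v w
    using that rtrancl_trans[OF W[OF that(1)] mono[OF that(2)]] unfolding C_iff by blast
  have cl: "u \<in> X s \<longleftrightarrow> v \<in> X s" if "(u, v) \<in> (E \<union> E\<inverse>)\<^sup>*" "s < d" for u v s
    using conn_closed[OF that(1), of "X s"] closed[OF that(2)] by blast
  have comp_r: "component V E (r s) = C \<inter> X s" if "s < d" for s
  proof (intro equalityI subsetI)
    fix v assume "v \<in> component V E (r s)"
    then show "v \<in> C \<inter> X s"
      using in_C[of "r s" v] cl[of "r s" v s] X(1) that unfolding component_def by auto
  next
    fix v assume v: "v \<in> C \<inter> X s"
    then obtain w where w: "w \<in> ?W" "(v, w) \<in> (E \<union> E\<inverse>)\<^sup>*" using C_W by blast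
    then have "w \<in> X s" using cl[of v w s] v that by simp
    then have "w = r s" using w(1) X(2,3) that by auto
    then show "v \<in> component V E (r s)" using v conn_sym[OF w(2)] C_iff unfolding component_def by simp
  qed
  have comp_p: "component V E p = C - (\<Union>s<d. X s)"
  proof (intro equalityI subsetI)
    fix v assume "v \<in> component V E p"
    then show "v \<in> C - (\<Union>s<d. X s)"
      using in_C[of p v] cl[of p v] X(2) unfolding component_def by auto
  next
    fix v assume v: "v \<in> C - (\<Union>s<d. X s)"
    then obtain w where w: "w \<in> ?W" "(v, w) \<in> (E \<union> E\<inverse>)\<^sup>*" using C_W by blast
    then have "w \<notin> (\<Union>s<d. X s)" using cl[of v w] v by auto
    then have "w = p" using w(1) X(1) by auto
    then show "v \<in> component V E p" using v conn_sym[OF w(2)] C_iff unfolding component_def by simp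
  qed
  have outside: "component V E u = component V E' u" if "u \<in> V" "u \<notin> C" for u
  proof -
    have "(u, v) \<in> (E \<union> E\<inverse>)\<^sup>*" if "(u, v) \<in> (E' \<union> E'\<inverse>)\<^sup>*" for v
      using key[OF that] in_C[OF _ conn_sym] \<open>u \<in> V\<close> \<open>u \<notin> C\<close> by blast
    then show ?thesis unfolding component_def using mono by blast
  qed
  have eq_C: "component V E' u = C \<longleftrightarrow> u \<in> C" if "u \<in> V" for u
  proof
    assume "component V E' u = C"
    moreover have "u \<in> component V E' u" using that unfolding component_def by simp
    ultimately show "u \<in> C" by simp
  next
    assume "u \<in> C"
    then show "component V E' u = C" using component_cong[of p u E' V] C_iff unfolding C_def by simp
  qed
  have CV: "C \<subseteq> V" unfolding C_def component_def by blast
  have "component V E ` (V - C) = components V E' - {C}"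
  proof -
    have "component V E ` (V - C) = component V E' ` (V - C)" using outside by (intro image_cong) auto
    also have "\<dots> = component V E' ` V - {C}" using eq_C by blast
    finally show ?thesis unfolding components_eq .
  qed
  moreover have "component V E ` C = component V E ` ?W"
  proof (intro equalityI subsetI)
    fix B assume "B \<in> component V E ` C"
    then obtain v where v: "v \<in> C" "B = component V E v" by blast
    then obtain w where w: "w \<in> ?W" "(v, w) \<in> (E \<union> E\<inverse>)\<^sup>*" using C_W by blast
    then show "B \<in> component V E ` ?W" using component_cong[OF w(2), of V] v(2) w(1) by (metis imageI)
  next
    fix B assume "B \<in> component V E ` ?W"
    moreover have "?W \<subseteq> C" using in_C[of w w for w] assms(1,2) by blast
    ultimately show "B \<in> component V E ` C" by blast
  qed
  moreover have "component V E ` ?W = insert (C - (\<Union>s<d. X s)) ((\<lambda>s. C \<inter> X s) ` {..<d})"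
    using comp_p comp_r by (simp add: image_image)
  moreover have "components V E = component V E ` (V - C) \<union> component V E ` C"
    unfolding components_eq image_Un[symmetric] using CV by (simp add: Un_absorb2)
  ultimately show ?thesis by simp
qed

subsection \<open>Parking trees\<close>

lemma d_parking_tree_distinct: "d_parking_tree d k T \<Longrightarrow> distinct (preorder T)"
  unfolding d_parking_tree_def by blast

lemma d_parking_tree_siblings:
  assumes T: "d_parking_tree d k T" and i: "i \<in> {1..k}"
  obtains S l m r where "S \<in> nodes T" "subtrees S = l @ m @ r" "map rlabel m = map (Lab i) [1..<d + 1]"
proof -
  obtain S where S: "S \<in> nodes T" "sublist (map (Lab i) [1..<d + 1]) (child_labels S)"
    using T i unfolding d_parking_tree_def by blast
  then obtain xs ys where "map rlabel (subtrees S) = xs @ map (Lab i) [1..<d + 1] @ ys"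
    unfolding sublist_def child_labels_def by blast
  then obtain l m r where "subtrees S = l @ m @ r" "map rlabel m = map (Lab i) [1..<d + 1]"
    by (auto simp: map_eq_append_conv simp del: upt_Suc) (metis map_append map_eq_append_conv)
  then show thesis using that S(1) by blast
qed

lemma rlabel_siblings:
  assumes "map rlabel m = map (Lab i) [1..<d + 1]"
  shows "length m = d" "s < d \<Longrightarrow> rlabel (m ! s) = Lab i (Suc s)"
proof -
  show len: "length m = d" using arg_cong[OF assms, of length] by simp
  have "map rlabel m ! s = map (Lab i) [1..<d + 1] ! s" using assms by simp
  then show "s < d \<Longrightarrow> rlabel (m ! s) = Lab i (Suc s)" using len by (simp del: upt_Suc)
qed

lemma child_edge: "S \<in> nodes T \<Longrightarrow> c \<in> set (subtrees S) \<Longrightarrow> (rlabel S, rlabel c) \<in> parent_edges T"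
  unfolding parent_edges_def child_labels_def by auto

lemma sibling_edges:
  assumes "S \<in> nodes T" "subtrees S = l @ m @ r" "map rlabel m = map (Lab i) [1..<d + 1]" "s \<in> {1..d}"
  shows "(rlabel S, Lab i s) \<in> parent_edges T"
proof -
  have s: "s - 1 < d" "Suc (s - 1) = s" using assms(4) by auto
  have "m ! (s - 1) \<in> set (subtrees S)" using nth_mem[of "s - 1" m] rlabel_siblings(1)[OF assms(3)] assms(2,4) by auto
  moreover have "rlabel (m ! (s - 1)) = Lab i s" using rlabel_siblings(2)[OF assms(3) s(1)] s(2) by simp
  ultimately show ?thesis using child_edge[OF assms(1)] by metis
qed

lemma common_parent_eq:
  assumes "d \<ge> 1" "distinct (preorder T)"
    "S \<in> nodes T" "subtrees S = l @ m @ r" "map rlabel m = map (Lab i) [1..<d + 1]"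
  shows "common_parent d T i = rlabel S"
  unfolding common_parent_def
proof (rule the_equality)
  show "\<forall>j\<in>{1..d}. (rlabel S, Lab i j) \<in> parent_edges T" using sibling_edges[OF assms(3-5)] by blast
  show "q = rlabel S" if "\<forall>j\<in>{1..d}. (q, Lab i j) \<in> parent_edges T" for q
    using that sibling_edges[OF assms(3-5), of 1] assms(1) parent_edges_unique[OF assms(2), of "rlabel S" "Lab i 1" q]
    by simp
qed

lemma initial_edges_parent_edges:
  assumes T: "d_parking_tree d k T" and "i \<le> k"
  shows "initial_edges d T i \<subseteq> parent_edges T"
proof
  fix e assume "e \<in> initial_edges d T i"
  then obtain j s where e: "e = (parent T (Lab j s), Lab j s)" "j \<in> {1..i}" "s \<in> {1..d}"
    unfolding initial_edges_def by blast
  then have "j \<in> {1..k}" using assms(2) by simp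
  then obtain S l m r where "S \<in> nodes T" "subtrees S = l @ m @ r" "map rlabel m = map (Lab j) [1..<d + 1]"
    using d_parking_tree_siblings[OF T] by blast
  then have "(rlabel S, Lab j s) \<in> parent_edges T" using sibling_edges e(3) by blast
  then show "e \<in> parent_edges T" using parent_eq[OF d_parking_tree_distinct[OF T]] e(1) by simp
qed

lemma initial_edges_Suc:
  assumes "distinct (preorder T)"
    "S \<in> nodes T" "subtrees S = l @ m @ r" "map rlabel m = map (Lab (Suc i)) [1..<d + 1]"
  shows "initial_edges d T (Suc i) = initial_edges d T i \<union> {rlabel S} \<times> (\<lambda>s. rlabel (m ! s)) ` {..<d}"
proof -
  have *: "parent T (Lab (Suc i) s) = rlabel S" if "s \<in> {1..d}" for s
    using parent_eq[OF assms(1) sibling_edges[OF assms(2-4) that]] .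
  have "initial_edges d T (Suc i) =
      initial_edges d T i \<union> (\<lambda>s. (parent T (Lab (Suc i) s), Lab (Suc i) s)) ` {1..d}"
    unfolding initial_edges_def by (auto simp: le_Suc_eq)
  also have "(\<lambda>s. (parent T (Lab (Suc i) s), Lab (Suc i) s)) ` {1..d} =
      (\<lambda>s. (rlabel S, Lab (Suc i) s)) ` Suc ` {..<d}"
    unfolding image_Suc_lessThan using * by (intro image_cong) auto
  also have "\<dots> = {rlabel S} \<times> (\<lambda>s. rlabel (m ! s)) ` {..<d}"
    using rlabel_siblings(2)[OF assms(4)] by auto
  finally show ?thesis .
qed

text \<open>Smaller indices stand further right, and all labels with index \<open>i\<close> are
  already used in \<open>m\<close>. So when the edges of index \<open>i\<close> have just been
  added, those to the siblings on the left are still missing.\<close>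

lemma left_sibling_label:
  assumes T: "d_parking_tree d k T" and S: "S \<in> nodes T" "subtrees S = l @ m @ r"
    and m: "map rlabel m = map (Lab i) [1..<d + 1]" and "d \<ge> 1" and c: "c \<in> set l" "rlabel c = Lab j s"
  shows "i < j"
proof (rule ccontr)
  assume "\<not> i < j"
  obtain q where q: "q < length l" "l ! q = c" using c(1) by (auto simp: in_set_conv_nth)
  have len: "length (child_labels S) = length l + length m + length r"
    using S(2) unfolding child_labels_def by simp
  have lm: "length m = d" using rlabel_siblings(1)[OF m] .
  have at_q: "child_labels S ! q = Lab j s" using q c(2) S(2) unfolding child_labels_def by (simp add: nth_append)
  have at_m: "child_labels S ! (length l + u) = Lab i (Suc u)" if "u < d" for u
    using that lm rlabel_siblings(2)[OF m that] S(2) unfolding child_labels_def by (simp add: nth_append)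
  show False
  proof (cases "j = i")
    case False
    then have "j < i" using \<open>\<not> i < j\<close> by simp
    have "0 < d" "q < length (child_labels S)" "length l + 0 < length (child_labels S)"
      using q(1) len lm \<open>d \<ge> 1\<close> by simp_all
    moreover have "\<forall>p<length (child_labels S). \<forall>q<length (child_labels S). \<forall>i j i' j'.
        child_labels S ! p = Lab i j \<and> child_labels S ! q = Lab i' j' \<and> i < i' \<longrightarrow> q < p"
      using T S(1) unfolding d_parking_tree_def by blast
    ultimately have "length l + 0 < q" using at_q at_m[of 0] \<open>j < i\<close> by blast
    then show False using q(1) by simp
  next
    case True
    have "Lab j s \<in> set (preorder T)"
      using rlabel_in_preorder[of c] c S set_preorder_subtree[OF nodes_trans[OF S(1) subtrees_nodes[of c S]]] by auto
    then have s: "s \<in> {1..d}" using T unfolding d_parking_tree_def by auto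
    have mc: "m ! (s - 1) \<in> set m" "rlabel (m ! (s - 1)) = rlabel c"
      using rlabel_siblings(2)[OF m, of "s - 1"] s lm c(2) True by auto
    have "distinct (concat (map preorder l) @ concat (map preorder m))"
      using distinct_preorder_subtree[OF d_parking_tree_distinct[OF T] S(1)] S(2) preorder_Node[of S]
      by (simp only: distinct_append map_append concat_append append_assoc[symmetric] distinct.simps)
    moreover have "rlabel c \<in> set (concat (map preorder l))" "rlabel c \<in> set (concat (map preorder m))"
      using rlabel_in_preorder[of c] rlabel_in_preorder[of "m ! (s - 1)"] c(1) mc by auto
    ultimately show False by auto
  qed
qed

section \<open>The partitions read off from the tree\<close>

definition tree_partition :: "nat \<Rightarrow> vlabel ptree \<Rightarrow> nat \<Rightarrow> nat set set" where
  "tree_partition d T i = (\<lambda>C. dfs T ` C) ` components (set (preorder T)) (initial_edges d T i)"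

lemma tree_partition_partition_on:
  assumes "distinct (preorder T)"
  shows "partition_on {1..length (preorder T)} (tree_partition d T i)"
proof -
  let ?P = "components (set (preorder T)) (initial_edges d T i)"
  have "partition_on (dfs T ` set (preorder T)) ((`) (dfs T) ` ?P - {{}})"
    using partition_on_inj_image[OF partition_on_components] bij_betw_dfs[OF assms]
    unfolding bij_betw_def by blast
  moreover have "{} \<notin> (`) (dfs T) ` ?P"
    using partition_onD3[OF partition_on_components[of "set (preorder T)" "initial_edges d T i"]] by auto
  ultimately show ?thesis
    using bij_betw_dfs[OF assms] unfolding bij_betw_def tree_partition_def by simp
qed

lemma tree_partition_0: "C \<in> tree_partition d T 0 \<Longrightarrow> \<exists>y. C = {y}"
  unfolding tree_partition_def components_eq component_def initial_edges_def by auto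

lemma tree_partition_top:
  assumes T: "d_parking_tree d k T"
  shows "tree_partition d T k = {{1..d * k + 1}}"
proof -
  note dist = d_parking_tree_distinct[OF T]
  let ?V = "set (preorder T)" and ?E = "initial_edges d T k"
  have "(q, c) \<in> ?E" if qc: "(q, c) \<in> parent_edges T" for q c
  proof -
    have "c \<in> ?V" "c \<noteq> Infty"
      using parent_edges_in_preorder[OF qc] root_not_child[OF dist qc] T unfolding d_parking_tree_def by auto
    then obtain j s where "c = Lab j s" "j \<in> {1..k}" "s \<in> {1..d}"
      using T unfolding d_parking_tree_def by auto
    then show ?thesis using parent_eq[OF dist qc] unfolding initial_edges_def by auto
  qed
  then have "parent_edges T \<subseteq> ?E \<union> ?E\<inverse>" by auto
  then have conn: "(rlabel T, v) \<in> (?E \<union> ?E\<inverse>)\<^sup>*" if "v \<in> ?V" for v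
    using root_reaches[OF that] rtrancl_mono by blast
  then have "component ?V ?E v = ?V" if "v \<in> ?V" for v
    using component_cong[OF conn[OF that], of ?V] unfolding component_def by blast
  then have "components ?V ?E = (\<lambda>_. ?V) ` ?V" unfolding components_eq by (intro image_cong) auto
  then have "components ?V ?E = {?V}" using rlabel_in_preorder[of T] by blast
  moreover have "length (preorder T) = d * k + 1" using T unfolding d_parking_tree_def by blast
  ultimately show ?thesis
    unfolding tree_partition_def using bij_betw_dfs[OF dist] unfolding bij_betw_def by simp
qed

text \<open>\<open>X\<close> meets every piece of \<open>C\<close> and no other block, so it selects
  exactly the pieces.\<close>

lemma merge_blocks_eq:
  assumes Q: "partition_on A Q" "C \<in> Q" and P: "P = (Q - {C}) \<union> F" "\<Union>F = C" and X: "X \<subseteq> C"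
    and F: "\<And>B. B \<in> F \<Longrightarrow> B \<inter> X \<noteq> {}"
  shows "merge_blocks P X = Q"
proof -
  have "B \<inter> X = {}" if "B \<in> Q - {C}" for B
    using partition_on_same_block[OF Q(1) _ Q(2)] that X by blast
  then have "{B \<in> P. B \<inter> X \<noteq> {}} = F" "{B \<in> P. B \<inter> X = {}} = Q - {C}"
    using P(1) F by blast+
  then show ?thesis unfolding merge_blocks_def using P(2) Q(2) by auto
qed

lemma tree_partition_step:
  assumes d: "d \<ge> 1" and T: "d_parking_tree d k T" and i: "i < k"
  defines "p \<equiv> common_parent d T (Suc i)"
  shows "interval_split d (dfs T p) (tree_partition d T i) (tree_partition d T (Suc i))"
    and "tree_partition d T (Suc i) =
      merge_blocks (tree_partition d T i) (insert (dfs T p) {dfs T (Lab (Suc i) j) | j. j \<in> {1..d}})"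
proof -
  note dist = d_parking_tree_distinct[OF T]
  have "Suc i \<in> {1..k}" using i by simp
  then obtain S l m r where S: "S \<in> nodes T" "subtrees S = l @ m @ r"
    and m: "map rlabel m = map (Lab (Suc i)) [1..<d + 1]"
    using d_parking_tree_siblings[OF T] by blast
  have p: "p = rlabel S" unfolding p_def using common_parent_eq[OF d dist S m] .
  have lm: "length m = d" and rl: "\<And>s. s < d \<Longrightarrow> rlabel (m ! s) = Lab (Suc i) (Suc s)"
    using rlabel_siblings[OF m] by auto
  define V where "V = set (preorder T)"
  define E where "E = initial_edges d T i"
  define E' where "E' = initial_edges d T (Suc i)"
  define X where "X s = set (preorder (m ! s))" for s
  define C where "C = component V E' p"
  have E': "E' = E \<union> {p} \<times> (\<lambda>s. rlabel (m ! s)) ` {..<d}"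
    unfolding E'_def E_def p using initial_edges_Suc[OF dist S m] .
  have sub: "E' \<subseteq> parent_edges T" unfolding E'_def using initial_edges_parent_edges[OF T] i by simp
  have E_label: "\<exists>j s. c = Lab j s \<and> j \<le> i" if "(q, c) \<in> E" for q c
    using that unfolding E_def initial_edges_def by auto
  have E'_label: "\<exists>j s. c = Lab j s \<and> j \<le> Suc i" if "(q, c) \<in> E'" for q c
    using that unfolding E'_def initial_edges_def by auto
  have S_Node: "S = Node p (l @ m @ r)" using S(2) p by (cases S) simp
  note disj = preorder_Node_disjoint[OF distinct_preorder_subtree[OF dist S(1), unfolded S_Node]]
  have child: "c \<in> nodes T" if "c \<in> set (l @ m @ r)" for c
    using nodes_trans[OF S(1) subtrees_nodes] S(2) that by simp
  have mem: "m ! s \<in> set (l @ m @ r)" if "s < d" for s using that lm by simp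
  have pV: "p \<in> V" unfolding p V_def using rlabel_in_preorder[of S] set_preorder_subtree[OF S(1)] by blast
  have XV: "X s \<subseteq> V" if "s < d" for s
    unfolding X_def V_def using set_preorder_subtree[OF child[OF mem[OF that]]] .
  have rX: "rlabel (m ! s) \<in> X s" for s unfolding X_def by (rule rlabel_in_preorder)
  have pX: "p \<notin> X s" if "s < d" for s
    using disj(1)[OF mem[OF that] mem[OF that]] unfolding X_def by blast
  have split: "components V E =
    (components V E' - {C}) \<union> insert (C - (\<Union>s<d. X s)) ((\<lambda>s. C \<inter> X s) ` {..<d})"
    unfolding C_def E'
  proof (rule components_remove_star[OF pV _ _ rX pX])
    show "(\<lambda>s. rlabel (m ! s)) ` {..<d} \<subseteq> V" using rX XV by blast
    show "q \<in> X s \<longleftrightarrow> c \<in> X s" if s: "s < d" and qc: "(q, c) \<in> E" for s q c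
    proof -
      \<comment> \<open>Edges of \<open>E\<close> lead to children of index at most
        \<open>i\<close>, so the edge above \<open>m ! s\<close> is not among them and its subtree
        is closed under \<open>E\<close>.\<close>
      have "c \<noteq> rlabel (m ! s)" using E_label[OF qc] rl[OF s] by auto
      moreover have "(q, c) \<in> parent_edges T" using qc sub E' by blast
      ultimately show ?thesis
        using parent_edge_closed[OF dist _ child[OF mem[OF s]]] unfolding X_def by blast
    qed
    show "s' = s" if "s < d" "s' < d" "rlabel (m ! s') \<in> X s" for s s'
    proof -
      have "m ! s = m ! s'"
        using disj(2)[OF mem[OF that(2)] mem[OF that(1)] rlabel_in_preorder] that(3) unfolding X_def by blast
      then show ?thesis using rl that(1,2) by (metis Suc_inject vlabel.inject)
    qed
  qed
  have CV: "C \<subseteq> V" unfolding C_def component_def by blast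
  \<comment> \<open>Children on the left of \<open>m\<close> have index above \<open>Suc i\<close>,
    so the edges above them are not in \<open>E'\<close>; their subtrees are closed under
    \<open>E'\<close> and do not contain \<open>p\<close>.\<close>
  have C_left: "v \<notin> set (concat (map preorder l))" if "v \<in> C" for v
  proof
    assume "v \<in> set (concat (map preorder l))"
    then obtain c where c: "c \<in> set l" "v \<in> set (preorder c)" by auto
    have cn: "c \<in> nodes T" using child c(1) by simp
    have "p \<in> set (preorder c) \<longleftrightarrow> v \<in> set (preorder c)"
    proof (rule conn_closed)
      show "(p, v) \<in> (E' \<union> E'\<inverse>)\<^sup>*" using that unfolding C_def component_def by simp
      fix q e assume qe: "(q, e) \<in> E'"
      have "e \<noteq> rlabel c"
        using E'_label[OF qe] left_sibling_label[OF T S m d c(1)] by (metis not_less)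
      then show "q \<in> set (preorder c) \<longleftrightarrow> e \<in> set (preorder c)"
        using parent_edge_closed[OF dist _ cn] qe sub by blast
    qed
    then show False using disj(1)[of c c p] c by simp
  qed
  obtain xs ys where "preorder T = xs @ preorder S @ ys" using preorder_subtree[OF S(1)] by blast
  define L where "L = concat (map preorder l)"
  define M where "M = (\<lambda>s. concat (map preorder (take s m)))"
  define R where "R = concat (map preorder r) @ ys"
  have M_d: "M d = concat (map preorder m)" unfolding M_def using lm by simp
  have preT: "preorder T = xs @ [p] @ L @ M d @ R"
    using \<open>preorder T = xs @ preorder S @ ys\<close> preorder_Node[of S] S(2) p unfolding L_def R_def M_d by simp
  have M_Suc: "M (Suc s) = M s @ preorder (m ! s)" if "s < d" for s
    unfolding M_def using that lm by (simp add: take_Suc_conv_app_nth)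
  have M_split: "\<exists>zs. M d = M (Suc s) @ zs" if "s < d" for s
  proof -
    have "map preorder m = map preorder (take (Suc s) m) @ map preorder (drop (Suc s) m)"
      unfolding map_append[symmetric] by simp
    then have "M d = M (Suc s) @ concat (map preorder (drop (Suc s) m))"
      unfolding M_d by (simp only: M_def concat_append)
    then show ?thesis by blast
  qed
  \<comment> \<open>\<open>interval_split\<close> requires \<open>t 0\<close> to be the label, the
    position of \<open>p\<close>. The first interval therefore also spans the subtrees in
    \<open>L\<close>, which is harmless because \<open>C\<close> does not meet them.\<close>
  define t where "t s = length xs + 1 + (if s = 0 then 0 else length L + length (M s))" for s :: nat
  have in_X: "v \<in> X s \<longleftrightarrow> t s < dfs T v \<and> dfs T v \<le> t (Suc s)" if s: "s < d" and v: "v \<in> C" for s v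
  proof -
    obtain zs where zs: "M d = M s @ preorder (m ! s) @ zs" using M_split[OF s] M_Suc[OF s] by auto
    have vT: "v \<in> set (preorder T)" using v CV unfolding V_def by blast
    show ?thesis
    proof (cases "s = 0")
      case True
      then have "M s = []" unfolding M_def by simp
      then have "preorder T = (xs @ [p]) @ (L @ preorder (m ! s)) @ (zs @ R)" using preT zs by simp
      from dfs_interval[OF dist this vT] show ?thesis
        using True C_left[OF v] M_Suc[OF s] \<open>M s = []\<close> unfolding X_def t_def L_def by simp
    next
      case False
      have "preorder T = (xs @ [p] @ L @ M s) @ preorder (m ! s) @ (zs @ R)" using preT zs by simp
      from dfs_interval[OF dist this vT] show ?thesis
        using False M_Suc[OF s] unfolding X_def t_def by (simp add: add.assoc)
    qed
  qed
  have in_UX: "v \<in> (\<Union>s<d. X s) \<longleftrightarrow> t 0 < dfs T v \<and> dfs T v \<le> t d" if v: "v \<in> C" for v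
  proof -
    have vT: "v \<in> set (preorder T)" using v CV unfolding V_def by blast
    have "set m = (!) m ` {..<d}" using lm by (auto simp: set_conv_nth)
    then have "set (M d) = (\<Union>s<d. X s)" unfolding M_d X_def by simp
    moreover have "preorder T = (xs @ [p]) @ (L @ M d) @ R" using preT by simp
    from dfs_interval[OF dist this vT] have "v \<in> set (M d) \<longleftrightarrow> t 0 < dfs T v \<and> dfs T v \<le> t d"
      using C_left[OF v] d unfolding t_def L_def by simp
    ultimately show ?thesis by blast
  qed
  have inj: "inj_on (dfs T) V" using bij_betw_dfs[OF dist] unfolding bij_betw_def V_def by blast
  have injP: "inj_on ((`) (dfs T)) (Pow V)" using inj_on_image_Pow[OF inj] .
  have C_in: "C \<in> components V E'" unfolding components_eq C_def using pV by blast
  have pC: "p \<in> C" unfolding C_def component_def using pV by simp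
  have compPow: "components V E' \<subseteq> Pow V"
    unfolding components_eq component_def by blast
  have diff: "(`) (dfs T) ` (components V E' - {C}) = tree_partition d T (Suc i) - {dfs T ` C}"
    using inj_on_image_set_diff[OF injP, of "components V E'" "{C}"] compPow C_in
    unfolding tree_partition_def V_def E'_def by auto
  define F where "F = insert (dfs T ` (C - (\<Union>s<d. X s))) ((\<lambda>s. dfs T ` (C \<inter> X s)) ` {..<d})"
  have P: "tree_partition d T i = (tree_partition d T (Suc i) - {dfs T ` C}) \<union> F"
  proof -
    have "tree_partition d T i = (`) (dfs T) ` components V E"
      unfolding tree_partition_def V_def E_def ..
    also have "\<dots> = (`) (dfs T) ` (components V E' - {C}) \<union> F"
      unfolding split F_def by (simp add: image_Un image_image)
    finally show ?thesis unfolding diff .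
  qed
  have dC: "dfs T ` C \<in> tree_partition d T (Suc i)"
    using C_in unfolding tree_partition_def V_def E'_def by blast
  have F1: "dfs T ` (C - (\<Union>s<d. X s)) = dfs T ` C - {t 0<..t d}"
    using in_UX by auto
  have F2: "dfs T ` (C \<inter> X s) = dfs T ` C \<inter> {t s<..t (Suc s)}" if "s < d" for s
    using in_X[OF that] by auto
  have dp: "dfs T p = t 0" unfolding t_def using dfs_eq[OF dist, of xs p "L @ M d @ R"] preT by simp
  have "F = insert (dfs T ` C - {t 0<..t d}) ((\<lambda>s. dfs T ` C \<inter> {t s<..t (Suc s)}) ` {..<d})"
    unfolding F_def F1 by (intro arg_cong2[where f = insert] refl image_cong) (use F2 in simp)
  then have "tree_partition d T i = (tree_partition d T (Suc i) - {dfs T ` C}) \<union>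
      insert (dfs T ` C - {t 0<..t d}) ((\<lambda>s. dfs T ` C \<inter> {t s<..t (Suc s)}) ` {..<d})"
    using P by simp
  moreover have "\<forall>s<d. t s \<le> t (Suc s)"
    unfolding t_def using M_Suc by auto
  moreover have "dfs T p \<in> dfs T ` C" using pC by blast
  ultimately show "interval_split d (dfs T p) (tree_partition d T i) (tree_partition d T (Suc i))"
    unfolding interval_split_def using dp[symmetric] by (intro bexI[OF _ dC] exI[of _ t] conjI)
  \<comment> \<open>Each piece cut off from \<open>C\<close> contains one of the merged elements;
    \<open>p\<close> lies in the remaining piece.\<close>
  have rC: "Lab (Suc i) j \<in> C \<inter> X (j - 1)" if "j \<in> {1..d}" for j
  proof -
    have j: "j - 1 < d" "Suc (j - 1) = j" using that by auto
    have "(p, rlabel (m ! (j - 1))) \<in> E'" unfolding E' using j by blast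
    then have "rlabel (m ! (j - 1)) \<in> C"
      unfolding C_def component_def using rX[of "j - 1"] XV[OF j(1)] by auto
    then show ?thesis using rX[of "j - 1"] rl[OF j(1)] j(2) by simp
  qed
  show "tree_partition d T (Suc i) =
      merge_blocks (tree_partition d T i) (insert (dfs T p) {dfs T (Lab (Suc i) j) | j. j \<in> {1..d}})"
  proof (rule merge_blocks_eq[OF tree_partition_partition_on[OF dist] dC P, symmetric])
    show "\<Union>F = dfs T ` C" unfolding F_def by blast
    show "insert (dfs T p) {dfs T (Lab (Suc i) j) | j. j \<in> {1..d}} \<subseteq> dfs T ` C"
      using pC rC by blast
    fix B assume "B \<in> F"
    then consider "B = dfs T ` (C - (\<Union>s<d. X s))" | s where "s < d" "B = dfs T ` (C \<inter> X s)"
      unfolding F_def by blast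
    then show "B \<inter> insert (dfs T p) {dfs T (Lab (Suc i) j) | j. j \<in> {1..d}} \<noteq> {}"
    proof cases
      case 1
      then have "dfs T p \<in> B" using pC pX by blast
      then show ?thesis by blast
    next
      case 2
      then have "dfs T (Lab (Suc i) (Suc s)) \<in> B" "Suc s \<in> {1..d}" using rC[of "Suc s"] by auto
      then show ?thesis by blast
    qed
  qed
qed

theorem theorem8p11:
  fixes d k :: nat and \<pi> :: "nat \<Rightarrow> nat set set" and T :: "vlabel ptree"
  assumes "d \<ge> 1"
    and "NCd_maximal_chain d k \<pi>"
    and "d_parking_tree d k T"
    and "chain_labels k \<pi> = parking_vector d k T"
  shows "(\<forall>i\<in>{0..k}.
            \<pi> i = (\<lambda>C. dfs T ` C) ` components (set (preorder T)) (initial_edges d T i)) \<and>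
         (\<forall>i\<in>{1..k}.
            \<pi> i = merge_blocks (\<pi> (i - 1))
                    (insert (dfs T (common_parent d T i)) {dfs T (Lab i j) | j. j \<in> {1..d}}))"
proof -
  note dist = d_parking_tree_distinct[OF assms(3)]
  have len: "length (preorder T) = d * k + 1" using assms(3) unfolding d_parking_tree_def by blast
  \<comment> \<open>Both lists start with index 1, so entry \<open>i\<close> belongs to the step
    from \<open>\<pi> i\<close> to \<open>\<pi> (Suc i)\<close> and to the siblings of index
    \<open>Suc i\<close>.\<close>
  have label: "cover_label (\<pi> i) (\<pi> (Suc i)) = dfs T (common_parent d T (Suc i))" if "i < k" for i
  proof -
    have "chain_labels k \<pi> ! i = parking_vector d k T ! i" using assms(4) by simp
    then show ?thesis using that unfolding chain_labels_def parking_vector_def by (simp del: upt_Suc)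
  qed
  have eq: "\<pi> i = tree_partition d T i" if "i \<le> k" for i
  proof (rule interval_split_sequence_unique[where A = "{1..d * k + 1}" and d = d
        and a = "\<lambda>j. dfs T (common_parent d T j)", OF _ _ _ _ _ _ _ _ that])
    show "partition_on {1..d * k + 1} (\<pi> i)" if "i \<le> k" for i
      using assms(2) that unfolding NCd_maximal_chain_def NCd_def by auto
    show "partition_on {1..d * k + 1} (tree_partition d T i)" for i
      using tree_partition_partition_on[OF dist] len by simp
    show "\<exists>y. C = {y}" if "C \<in> \<pi> 0" for C
      using assms(2) that unfolding NCd_maximal_chain_def by auto
    show "\<exists>y. C = {y}" if "C \<in> tree_partition d T 0" for C
      using tree_partition_0[OF that] .
    show "\<pi> k = tree_partition d T k"
      using assms(2) tree_partition_top[OF assms(3)] unfolding NCd_maximal_chain_def by simp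
    show "interval_split d (dfs T (common_parent d T (Suc i))) (\<pi> i) (\<pi> (Suc i))" if "i < k" for i
      using NCd_maximal_chain_interval_split[OF assms(1,2) that] label[OF that] by simp
    show "interval_split d (dfs T (common_parent d T (Suc i))) (tree_partition d T i) (tree_partition d T (Suc i))"
      if "i < k" for i
      using tree_partition_step(1)[OF assms(1,3) that] .
  qed simp
  \<comment> \<open>The merging statement holds for the partitions of the tree and is transferred
    along \<open>eq\<close>.\<close>
  have merge: "\<pi> i = merge_blocks (\<pi> (i - 1))
      (insert (dfs T (common_parent d T i)) {dfs T (Lab i j) | j. j \<in> {1..d}})" if "i \<in> {1..k}" for i
  proof -
    have i: "i - 1 < k" "Suc (i - 1) = i" "i \<le> k" "i - 1 \<le> k" using that by auto
    show ?thesis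
      using tree_partition_step(2)[OF assms(1,3) i(1)] eq[OF i(3)] eq[OF i(4)] unfolding i(2) by simp
  qed
  have "\<pi> i = (\<lambda>C. dfs T ` C) ` components (set (preorder T)) (initial_edges d T i)" if "i \<in> {0..k}" for i
    using eq[of i] that unfolding tree_partition_def by simp
  then show ?thesis using merge by blast
qed

end
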